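(* Let the jump rates satisfy the standing hypothesis. There exist $\theta=\theta(d,\lambda)\in(0,1)$ and finite positive constants $C=C(d,\lambda)$ and $R_0=R_0(d,\lambda,\mathbf r)$ such that for every $\rho\in(0,1)$, every $L\ge R_0$ and every $u\in\mathcal A(\Lambda_{3L})$, $$\frac1{|\Lambda_L|}\big\langle\mathsf A_{L+2\mathbf r}u\,(-\mathcal L_{\Lambda_L}\mathsf A_{L+2\mathbf r}u)\big\rangle_\rho\le\frac{CL^{-2}}{|\Lambda_{3L}|}\langle u^2\rangle_\rho+\frac{\theta}{|\Lambda_{3L}|}\big\langle u(-\mathcal L_{\Lambda_{3L}}u)\big\rangle_\rho.$$
   Context: $\mathcal X=\{0,1\}^{\mathbb Z^d}$; bonds are pairs $b=\{x,y\}$ with $|x-y|=1$; $\eta^{x,y}$ exchanges the values at $x,y$; $\pi_bf(\eta)=f(\eta^b)-f(\eta)$; $(\tau_x\eta)_y=\eta_{x+y}$, $(\tau_xf)(\eta)=f(\tau_x\eta)$; $\mathbb P_\rho$ is the Bernoulli product measure of density $\rho$ on $\mathcal X$, with expectation $\langle\cdot\rangle_\rho$ or $\mathbb E_\rho$. Standing hypothesis on rates $c_b=c_{x,y}=c_{y,x}$: (1) $c_{x,y}(\eta)$ depends only on $\{\eta_z:|z-x|\le\mathbf r\}$, $\mathbf r\in\mathbb N_+$, and $1\le c_{x,y}\le\lambda$; (2) $c_{x,y}=\tau_xc_{0,y-x}$; (3) $c_{x,y}$ does not depend on $\eta_x,\eta_y$. $\Lambda_L=(-\frac L2,\frac L2)^d\cap\mathbb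 Z^d$ for real $L>0$. For finite $\Lambda$: $\Lambda^*$ is the set of bonds with both endpoints in $\Lambda$; $\overline{\Lambda^*}=\{\{x,x+e_i\}:x\in\Lambda,1\le i\le d\}$; $\partial\Lambda=\{x\in\Lambda:\exists y\notin\Lambda,|x-y|=1\}$; $\Lambda^-=\Lambda\setminus\partial\Lambda$; $\mathcal F_0(\Lambda^-)$ is the set of functions of $(\eta_x)_{x\in\Lambda^-}$; $\mathcal L_\Lambda=\sum_{b\in\overline{\Lambda^*}}c_b\pi_b$, for which $\langle v(-\mathcal L_\Lambda u)\rangle_\rho=\frac12\sum_{b\in\overline{\Lambda^*}}\langle c_b(\pi_bv)(\pi_bu)\rangle_\rho$. $H^1(\Lambda)$ is the set of measurable $f:\mathcal X\to\mathbb R$ with $\langle f^2\rangle_\rho+\sum_{b\in\Lambda^*}\langle(\pi_bf)^2\rangle_\rho<\infty$. The space of harmonic functions is $\mathcal A(\Lambda)=\{u\in H^1(\Lambda):\langle v(-\mathcal L_\Lambda u)\rangle_\rho=0\ \ \forall v\in\mathcal F_0(\Lambda^-)\}$ (elements may depend on the configuration outside $\Lambda$). $\mathsf A_Lf=\mathbb E_\rho[f\mid\sigma((\eta_x)_{x\in\Lambda_L})]$. *)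

theory Defs
  imports "HOL-Probability.Probability"
begin

text \<open>
  The lattice \<open>Z\<^sup>d\<close> is the type \<open>int ^ 'd\<close>.
  A configuration sends each site to its occupation variable, with \<open>True\<close> for 1 and \<open>False\<close> for 0.
\<close>

type_synonym 'd site = "int ^ 'd"
type_synonym 'd config = "int ^ 'd \<Rightarrow> bool"

definition site_norm :: "('d::finite) site \<Rightarrow> real" where
  "site_norm x = norm ((\<chi> i. real_of_int (x $ i)) :: real ^ 'd)"

definition bonds :: "('d::finite) site set set" where
  "bonds = {{x, y} | x y. site_norm (x - y) = 1}"

text \<open>For \<open>b = {x, y}\<close> this is \<open>\<eta>\<^sup>x\<^sup>,\<^sup>y\<close>, see \<open>exchange_bond\<close> below.\<close>

definition exchange :: "('d::finite) site set \<Rightarrow> 'd config \<Rightarrow> 'd config" where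
  "exchange b \<eta> = (\<lambda>z. if z \<in> b then \<eta> (the_elem (b - {z})) else \<eta> z)"

lemma exchange_bond:
  assumes "x \<noteq> y"
  shows "exchange {x, y} \<eta> = \<eta>(x := \<eta> y, y := \<eta> x)"
proof -
  have "{x, y} - {x} = {y}" "{x, y} - {y} = {x}"
    using assms by auto
  then show ?thesis
    by (auto simp: exchange_def fun_eq_iff)
qed

definition pi_bond :: "('d::finite) site set \<Rightarrow> ('d config \<Rightarrow> real) \<Rightarrow> 'd config \<Rightarrow> real" where
  "pi_bond b f = (\<lambda>\<eta>. f (exchange b \<eta>) - f \<eta>)"

definition shift :: "('d::finite) site \<Rightarrow> 'd config \<Rightarrow> 'd config" where
  "shift x \<eta> = (\<lambda>y. \<eta> (x + y))"

definition depends_only_on :: "('d::finite) site set \<Rightarrow> ('d config \<Rightarrow> real) \<Rightarrow> bool" where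
  "depends_only_on A f \<longleftrightarrow> (\<forall>\<eta> \<xi>. (\<forall>z\<in>A. \<eta> z = \<xi> z) \<longrightarrow> f \<eta> = f \<xi>)"

text \<open>Rates are indexed by unordered pairs, so that \<open>c\<^sub>x\<^sub>,\<^sub>y = c\<^sub>y\<^sub>,\<^sub>x\<close> is built in.\<close>

definition admissible_rates ::
    "nat \<Rightarrow> real \<Rightarrow> (('d::finite) site set \<Rightarrow> 'd config \<Rightarrow> real) \<Rightarrow> bool" where
  "admissible_rates r lam c \<longleftrightarrow>
    (\<forall>x y. site_norm (x - y) = 1 \<longrightarrow>
       depends_only_on {z. site_norm (z - x) \<le> real r} (c {x, y}) \<and>
       (\<forall>\<eta>. 1 \<le> c {x, y} \<eta> \<and> c {x, y} \<eta> \<le> lam) \<and>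
       (\<forall>\<eta>. c {x, y} \<eta> = c {0, y - x} (shift x \<eta>)) \<and>
       depends_only_on (- {x, y}) (c {x, y}))"

definition bernoulli_measure :: "real \<Rightarrow> ('d::finite) config measure" where
  "bernoulli_measure \<rho> = PiM UNIV (\<lambda>_. measure_pmf (bernoulli_pmf \<rho>))"

definition cube :: "real \<Rightarrow> ('d::finite) site set" where
  "cube L = {x. \<forall>i. - L / 2 < real_of_int (x $ i) \<and> real_of_int (x $ i) < L / 2}"

definition inner_bonds :: "('d::finite) site set \<Rightarrow> 'd site set set" where
  "inner_bonds \<Lambda> = {b \<in> bonds. b \<subseteq> \<Lambda>}"

text \<open>\<open>axis i 1\<close> is the unit vector \<open>e\<^sub>i\<close>; these bonds may leave \<open>\<Lambda>\<close>.\<close>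

definition closed_bonds :: "('d::finite) site set \<Rightarrow> 'd site set set" where
  "closed_bonds \<Lambda> = {{x, x + axis i 1} | x i. x \<in> \<Lambda>}"

definition inner_boundary :: "('d::finite) site set \<Rightarrow> 'd site set" where
  "inner_boundary \<Lambda> = {x \<in> \<Lambda>. \<exists>y. y \<notin> \<Lambda> \<and> site_norm (x - y) = 1}"

definition lattice_interior :: "('d::finite) site set \<Rightarrow> 'd site set" where
  "lattice_interior \<Lambda> = \<Lambda> - inner_boundary \<Lambda>"

definition generator ::
    "(('d::finite) site set \<Rightarrow> 'd config \<Rightarrow> real) \<Rightarrow> 'd site set \<Rightarrow>
     ('d config \<Rightarrow> real) \<Rightarrow> 'd config \<Rightarrow> real" where
  "generator c \<Lambda> u = (\<lambda>\<eta>. \<Sum>b\<in>closed_bonds \<Lambda>. c b \<eta> * pi_bond b u \<eta>)"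

definition energy ::
    "(('d::finite) site set \<Rightarrow> 'd config \<Rightarrow> real) \<Rightarrow> real \<Rightarrow> 'd site set \<Rightarrow>
     ('d config \<Rightarrow> real) \<Rightarrow> ('d config \<Rightarrow> real) \<Rightarrow> real" where
  "energy c \<rho> \<Lambda> v u = (\<integral>\<eta>. v \<eta> * - generator c \<Lambda> u \<eta> \<partial>bernoulli_measure \<rho>)"

definition H1 :: "real \<Rightarrow> ('d::finite) site set \<Rightarrow> ('d config \<Rightarrow> real) set" where
  "H1 \<rho> \<Lambda> = {f \<in> borel_measurable (bernoulli_measure \<rho>).
     (\<integral>\<^sup>+ \<eta>. ennreal ((f \<eta>)\<^sup>2) \<partial>bernoulli_measure \<rho>) +
     (\<Sum>b\<in>inner_bonds \<Lambda>. \<integral>\<^sup>+ \<eta>. ennreal ((pi_bond b f \<eta>)\<^sup>2) \<partial>bernoulli_measure \<rho>) < \<infinity>}"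

definition harmonic ::
    "(('d::finite) site set \<Rightarrow> 'd config \<Rightarrow> real) \<Rightarrow> real \<Rightarrow> 'd site set \<Rightarrow>
     ('d config \<Rightarrow> real) set" where
  "harmonic c \<rho> \<Lambda> = {u \<in> H1 \<rho> \<Lambda>.
     \<forall>v. depends_only_on (lattice_interior \<Lambda>) v \<longrightarrow> energy c \<rho> \<Lambda> v u = 0}"

definition site_algebra :: "('d::finite) site set \<Rightarrow> 'd config measure" where
  "site_algebra \<Lambda> = sigma UNIV {(\<lambda>\<eta>. \<eta> x) -` B | x B. x \<in> \<Lambda>}"

lemma subalgebra_site_algebra:
  fixes \<Lambda> :: "('d::finite) site set"
  shows "subalgebra (bernoulli_measure \<rho>) (site_algebra \<Lambda>)"
proof -
  have sp: "space (bernoulli_measure \<rho> :: 'd config measure) = UNIV"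
    by (simp add: bernoulli_measure_def space_PiM)
  have "(\<lambda>\<eta>. \<eta> x) -` B \<in> sets (bernoulli_measure \<rho> :: 'd config measure)" for x :: "'d site" and B
  proof -
    have "(\<lambda>\<eta>. \<eta> x) \<in> bernoulli_measure \<rho> \<rightarrow>\<^sub>M measure_pmf (bernoulli_pmf \<rho>)"
      unfolding bernoulli_measure_def by (rule measurable_component_singleton) simp
    from measurable_sets[OF this, of B] show ?thesis
      by (simp add: sp)
  qed
  then have "{(\<lambda>\<eta>. \<eta> x) -` B | x B. x \<in> \<Lambda>} \<subseteq> sets (bernoulli_measure \<rho> :: 'd config measure)"
    by auto
  from sets.sigma_sets_subset[OF this]
  have "sigma_sets UNIV {(\<lambda>\<eta>. \<eta> x) -` B | x B. x \<in> \<Lambda>}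
      \<subseteq> sets (bernoulli_measure \<rho> :: 'd config measure)"
    by (simp only: sp)
  then show ?thesis
    by (simp add: subalgebra_def site_algebra_def sp)
qed

text \<open>
  The conditional expectation is determined up to a null set; exchanges preserve
  \<open>bernoulli_measure \<rho>\<close>, so the energy does not depend on the chosen version.
\<close>

definition local_average :: "real \<Rightarrow> real \<Rightarrow> (('d::finite) config \<Rightarrow> real) \<Rightarrow> 'd config \<Rightarrow> real" where
  "local_average \<rho> L = real_cond_exp (bernoulli_measure \<rho>) (site_algebra (cube L))"

end

theory Submission
  imports Defs
begin

text \<open>
  The test function is \<open>T u\<close>, where \<open>T\<close> keeps the occupation variable at each site \<open>x\<close> with
  probability \<open>p x\<close> and resamples it otherwise; \<open>p\<close> equals 1 on an inner box and decreases to 0 like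
  \<open>1 - t\<^sup>2\<close> over a layer of width \<open>h\<close>.  On bonds of the inner box \<open>T\<close> commutes with the rates, and the
  corresponding terms dominate the energy of the local average of \<open>u\<close>; the remaining ones are bounded by
  the energy of \<open>u\<close> in the layer.  The commutator of \<open>T\<close> with an exchange is of size \<open>\<bar>p x - p y\<bar>\<close>
  times an influence of \<open>u\<close>.  Since \<open>(p x - p y)\<^sup>2 \<le> 4 h\<^sup>-\<^sup>2 (1 - p y)\<close>, the sum of these errors is at most
  of order \<open>h\<^sup>-\<^sup>2 \<langle>u\<^sup>2\<rangle>\<close>: in the orthogonal decomposition of \<open>u\<close> it is governed by the probability that
  exactly one of independent events fails.  Hole filling gives a contraction factor depending only on
  \<open>lam\<close>.  As the local average is harmonic in the smaller box, the step can be repeated a number of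
  times depending on \<open>d\<close> and \<open>lam\<close>, which compensates the volume factor.
\<close>

section \<open>Local functions and single-site averages\<close>

text \<open>Harmonicity may be tested only against functions of the interior sites, and multiplying
  by a cutoff does not remove the dependence on a site. Averaging does, but a sharp conditional
  expectation has a commutator of order one with exchanges across the edge of its box; hence the
  graded \<open>p\<close>. A linear profile would not do: at the first sites of the layer
  \<open>1 - p\<close> is \<open>1 / h\<close> while the squared slope is \<open>1 / h^2\<close>, so
  the error would only be of order \<open>1 / h\<close>. The second obstacle is that the rates
  depend on the configuration, so resampling within the range of a rate does not commute with it.
  Therefore a margin \<open>r\<close> separates the inner box from the layer, which is also the
  origin of the enlarged cube in the local average; in the layer only Cauchy-Schwarz is left, with a
  loss \<open>lam\<close> that hole filling absorbs. All estimates are made for functions of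
  finitely many sites, where integrals are finite sums and null sets disappear. A general
  \<open>u\<close> is first conditioned on a finite box containing the large cube and the range of
  its rates: this keeps the equation and increases neither the energy nor the \<open>L^2\<close>
  norm.\<close>

definition local_fn :: "('d::finite config \<Rightarrow> real) \<Rightarrow> bool" where
  "local_fn f \<longleftrightarrow> (\<exists>W. finite W \<and> depends_only_on W f)"

lemma depends_only_onD: "depends_only_on W f \<Longrightarrow> (\<And>z. z \<in> W \<Longrightarrow> \<eta> z = \<xi> z) \<Longrightarrow> f \<eta> = f \<xi>"
  unfolding depends_only_on_def by blast

lemma depends_only_on_mono: "depends_only_on A f \<Longrightarrow> A \<subseteq> B \<Longrightarrow> depends_only_on B f"
  unfolding depends_only_on_def by blast

lemma depends_only_on_compose2:
  assumes "depends_only_on W f" "depends_only_on W g"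
  shows "depends_only_on W (\<lambda>\<eta>. h (f \<eta>) (g \<eta>))"
  using assms unfolding depends_only_on_def by metis

lemma depends_only_on_compose:
  "depends_only_on W f \<Longrightarrow> depends_only_on W (\<lambda>\<eta>. h (f \<eta>))"
  unfolding depends_only_on_def by metis

lemma depends_only_on_upd: "depends_only_on W f \<Longrightarrow> depends_only_on (W - {x}) (\<lambda>\<eta>. f (\<eta>(x := v)))"
  unfolding depends_only_on_def by auto

lemma depends_only_on_const [simp]: "depends_only_on W (\<lambda>\<eta>. k)"
  by (simp add: depends_only_on_def)

lemma exchange_exchange: "x \<noteq> y \<Longrightarrow> exchange {x, y} (exchange {x, y} \<eta>) = \<eta>"
  by (auto simp: exchange_bond fun_eq_iff)

lemma depends_only_on_exchange:
  assumes f: "depends_only_on W f" and "x \<in> W" "y \<in> W" "x \<noteq> y"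
  shows "depends_only_on W (\<lambda>\<eta>. f (exchange {x, y} \<eta>))"
  unfolding depends_only_on_def
proof (intro allI impI)
  fix \<eta> \<xi> :: "'a config" assume "\<forall>z\<in>W. \<eta> z = \<xi> z"
  then show "f (exchange {x, y} \<eta>) = f (exchange {x, y} \<xi>)"
    by (intro depends_only_onD[OF f]) (use assms in \<open>auto simp: exchange_bond\<close>)
qed

lemma depends_only_on_pi_bond:
  assumes "depends_only_on W f" "x \<in> W" "y \<in> W" "x \<noteq> y"
  shows "depends_only_on W (pi_bond {x, y} f)"
  unfolding pi_bond_def
  by (rule depends_only_on_compose2[OF depends_only_on_exchange[OF assms] assms(1)])

lemma pi_bond_eq_0:
  assumes "depends_only_on W f" "x \<notin> W" "y \<notin> W" "x \<noteq> y"
  shows "pi_bond {x, y} f = (\<lambda>\<eta>. 0)"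
proof
  fix \<eta>
  have "f (exchange {x, y} \<eta>) = f \<eta>"
    by (rule depends_only_onD[OF assms(1)]) (use assms in \<open>auto simp: exchange_bond\<close>)
  then show "pi_bond {x, y} f \<eta> = 0" by (simp add: pi_bond_def)
qed

lemma local_fnI: "finite W \<Longrightarrow> depends_only_on W f \<Longrightarrow> local_fn f"
  unfolding local_fn_def by blast

lemma local_fn_compose2:
  assumes "local_fn f" "local_fn g" shows "local_fn (\<lambda>\<eta>. h (f \<eta>) (g \<eta>))"
proof -
  obtain V W where "finite V" "depends_only_on V f" "finite W" "depends_only_on W g"
    using assms unfolding local_fn_def by blast
  then have "depends_only_on (V \<union> W) f" "depends_only_on (V \<union> W) g" "finite (V \<union> W)"
    by (auto elim: depends_only_on_mono)
  then show ?thesis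
    using depends_only_on_compose2[of "V \<union> W" f g h] local_fnI by blast
qed

lemma local_fn_compose: "local_fn f \<Longrightarrow> local_fn (\<lambda>\<eta>. h (f \<eta>))"
  unfolding local_fn_def using depends_only_on_compose[of _ f h] by blast

lemma local_fn_const [intro, simp]: "local_fn (\<lambda>\<eta>. k)"
  by (rule local_fnI[of "{}"]) auto

lemma local_fn_arith [intro]:
  assumes "local_fn f" "local_fn g"
  shows "local_fn (\<lambda>\<eta>. f \<eta> + g \<eta>)" "local_fn (\<lambda>\<eta>. f \<eta> - g \<eta>)" "local_fn (\<lambda>\<eta>. f \<eta> * g \<eta>)"
  using local_fn_compose2[OF assms, of "(+)"] local_fn_compose2[OF assms, of "(-)"]
    local_fn_compose2[OF assms, of "(*)"] by simp_all

lemma local_fn_unary [intro]: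
  assumes "local_fn f"
  shows "local_fn (\<lambda>\<eta>. - f \<eta>)" "local_fn (\<lambda>\<eta>. (f \<eta>)\<^sup>2)" "local_fn (\<lambda>\<eta>. \<bar>f \<eta>\<bar>)" "local_fn (\<lambda>\<eta>. sqrt (f \<eta>))"
  using assms by (auto intro: local_fn_compose[of f uminus] local_fn_compose[of f "\<lambda>t. t\<^sup>2"]
    local_fn_compose[of f abs] local_fn_compose[of f sqrt])

lemma local_fn_upd [intro]: "local_fn f \<Longrightarrow> local_fn (\<lambda>\<eta>. f (\<eta>(x := v)))"
  unfolding local_fn_def using depends_only_on_upd by blast

lemma local_fn_exchange [intro]:
  assumes "local_fn f" "x \<noteq> y" shows "local_fn (\<lambda>\<eta>. f (exchange {x, y} \<eta>))"
proof -
  obtain W where W: "finite W" "depends_only_on W f" using assms unfolding local_fn_def by blast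
  show ?thesis
    by (rule local_fnI[of "insert x (insert y W)"], simp add: W, rule depends_only_on_exchange)
       (use assms in \<open>auto intro: depends_only_on_mono[OF W(2)]\<close>)
qed

lemma local_fn_pi_bond [intro]: "local_fn f \<Longrightarrow> x \<noteq> y \<Longrightarrow> local_fn (pi_bond {x, y} f)"
  unfolding pi_bond_def by (intro local_fn_arith local_fn_exchange)

text \<open>The conditional expectation given all sites other than \<open>x\<close>, as a formula
  valid at every configuration, so that no null sets enter.\<close>

definition site_avg :: "real \<Rightarrow> 'd::finite site \<Rightarrow> ('d config \<Rightarrow> real) \<Rightarrow> 'd config \<Rightarrow> real" where
  "site_avg \<rho> x f = (\<lambda>\<eta>. \<rho> * f (\<eta>(x := True)) + (1 - \<rho>) * f (\<eta>(x := False)))"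

lemma site_avg_local [intro]: "local_fn f \<Longrightarrow> local_fn (site_avg \<rho> x f)"
  unfolding site_avg_def by (intro local_fn_arith local_fn_const local_fn_upd)

lemma depends_only_on_site_avg:
  "depends_only_on W f \<Longrightarrow> depends_only_on (W - {x}) (site_avg \<rho> x f)"
  unfolding site_avg_def
  by (rule depends_only_on_compose2[of _ "\<lambda>\<eta>. f (\<eta>(x := True))" "\<lambda>\<eta>. f (\<eta>(x := False))"
      "\<lambda>a b. \<rho> * a + (1 - \<rho>) * b"]) (simp_all add: depends_only_on_upd)

section \<open>The Bernoulli measure\<close>

lemma space_bernoulli [simp]: "space (bernoulli_measure \<rho>) = UNIV"
  by (simp add: bernoulli_measure_def space_PiM)

lemma prob_space_bernoulli: "prob_space (bernoulli_measure \<rho>)"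
  unfolding bernoulli_measure_def by (intro prob_space_PiM prob_space_measure_pmf)

lemma measurable_site [measurable]:
  "(\<lambda>\<eta>. \<eta> x) \<in> measurable (bernoulli_measure \<rho>) (count_space UNIV)"
proof -
  have "(\<lambda>\<eta>. \<eta> x) \<in> bernoulli_measure \<rho> \<rightarrow>\<^sub>M measure_pmf (bernoulli_pmf \<rho>)"
    unfolding bernoulli_measure_def by (rule measurable_component_singleton) simp
  then show ?thesis by (simp cong: measurable_cong_sets)
qed

text \<open>A local function is constant on each cylinder over \<open>W\<close>, and a cylinder is
  coded by its set \<open>S\<close> of occupied sites. Integrability and integrals thereby reduce to
  cylinder probabilities.\<close>

lemma local_expansion:
  assumes "finite W" "depends_only_on W f"
  shows "f \<eta> = (\<Sum>S\<in>Pow W. f (\<lambda>x. x \<in> S) * indicator {\<eta>. \<forall>x\<in>W. \<eta> x = (x \<in> S)} \<eta>)"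
proof -
  have "(\<Sum>S\<in>Pow W. f (\<lambda>x. x \<in> S) * indicator {\<eta>. \<forall>x\<in>W. \<eta> x = (x \<in> S)} \<eta>)
     = (\<Sum>S\<in>Pow W. if S = {x\<in>W. \<eta> x} then f (\<lambda>x. x \<in> S) else 0)"
    by (rule sum.cong) (auto simp: indicator_def)
  also have "\<dots> = f (\<lambda>x. x \<in> {x\<in>W. \<eta> x})"
    using assms(1) by (subst sum.delta) auto
  also have "\<dots> = f \<eta>"
    by (rule depends_only_onD[OF assms(2)]) auto
  finally show ?thesis by simp
qed

lemma cylinder_sets [measurable]:
  assumes "finite W"
  shows "{\<eta>. \<forall>x\<in>W. \<eta> x = s x} \<in> sets (bernoulli_measure \<rho>)"
proof -
  have "{\<eta> \<in> space (bernoulli_measure \<rho>). \<forall>x\<in>W. \<eta> x = s x} \<in> sets (bernoulli_measure \<rho>)"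
    using assms by measurable
  then show ?thesis by simp
qed

lemma measure_cylinder:
  assumes "finite W" "0 < \<rho>" "\<rho> < 1"
  shows "measure (bernoulli_measure \<rho>) {\<eta>. \<forall>x\<in>W. \<eta> x = s x}
    = (\<Prod>x\<in>W. if s x then \<rho> else 1 - \<rho>)"
proof -
  interpret product_prob_space "\<lambda>_. measure_pmf (bernoulli_pmf \<rho>)" UNIV
    by unfold_locales
  have "{\<eta>. \<forall>x\<in>W. \<eta> x = s x} = {\<eta> \<in> space (bernoulli_measure \<rho>). \<forall>x\<in>W. \<eta> x \<in> {s x}}"
    by auto
  also have "emeasure (bernoulli_measure \<rho>) \<dots> = (\<Prod>x\<in>W. emeasure (measure_pmf (bernoulli_pmf \<rho>)) {s x})"
    unfolding bernoulli_measure_def by (rule emeasure_PiM_Collect) (use assms in auto)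
  also have "\<dots> = (\<Prod>x\<in>W. ennreal (if s x then \<rho> else 1 - \<rho>))"
    using assms by (intro prod.cong) (auto simp: emeasure_pmf_single)
  also have "\<dots> = ennreal (\<Prod>x\<in>W. if s x then \<rho> else 1 - \<rho>)"
    using assms by (intro prod_ennreal) auto
  finally show ?thesis
    using assms by (simp add: measure_def prod_nonneg)
qed

lemma local_integrable [intro]:
  assumes "local_fn f" shows "integrable (bernoulli_measure \<rho>) f"
proof -
  interpret prob_space "bernoulli_measure \<rho>" by (rule prob_space_bernoulli)
  obtain W where W: "finite W" "depends_only_on W f" using assms unfolding local_fn_def by blast
  have "integrable (bernoulli_measure \<rho>)
    (\<lambda>\<eta>. \<Sum>S\<in>Pow W. f (\<lambda>x. x \<in> S) * indicator {\<eta>. \<forall>x\<in>W. \<eta> x = (x \<in> S)} \<eta>)"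
    using W by (intro Bochner_Integration.integrable_sum integrable_mult_right integrable_real_indicator)
       (auto simp: emeasure_eq_measure intro: cylinder_sets)
  then show ?thesis
    unfolding local_expansion[OF W, symmetric] .
qed

lemma local_integral:
  assumes W: "finite W" "depends_only_on W f" and \<rho>: "0 < \<rho>" "\<rho> < 1"
  shows "(\<integral>\<eta>. f \<eta> \<partial>bernoulli_measure \<rho>)
    = (\<Sum>S\<in>Pow W. (\<Prod>x\<in>W. if x \<in> S then \<rho> else 1 - \<rho>) * f (\<lambda>x. x \<in> S))"
proof -
  interpret prob_space "bernoulli_measure \<rho>" by (rule prob_space_bernoulli)
  have "(\<integral>\<eta>. f \<eta> \<partial>bernoulli_measure \<rho>) = (\<integral>\<eta>. (\<Sum>S\<in>Pow W. f (\<lambda>x. x \<in> S) *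
      indicator {\<eta>. \<forall>x\<in>W. \<eta> x = (x \<in> S)} \<eta>) \<partial>bernoulli_measure \<rho>)"
    unfolding local_expansion[OF W, symmetric] ..
  also have "\<dots> = (\<Sum>S\<in>Pow W. (\<integral>\<eta>. f (\<lambda>x. x \<in> S) *
      indicator {\<eta>. \<forall>x\<in>W. \<eta> x = (x \<in> S)} \<eta> \<partial>bernoulli_measure \<rho>))"
    using W by (intro Bochner_Integration.integral_sum integrable_mult_right integrable_real_indicator)
       (auto simp: emeasure_eq_measure intro: cylinder_sets)
  also have "\<dots> = (\<Sum>S\<in>Pow W. f (\<lambda>x. x \<in> S) * measure (bernoulli_measure \<rho>) {\<eta>. \<forall>x\<in>W. \<eta> x = (x \<in> S)})"
    by simp
  finally show ?thesis using measure_cylinder[OF W(1) \<rho>] by (simp add: mult.commute)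
qed

text \<open>Every cylinder has positive mass because the density is strictly between 0 and 1. This
  turns almost sure identities between local functions into pointwise ones.\<close>

lemma local_eq_0:
  assumes W: "finite W" "depends_only_on W f" and \<rho>: "0 < \<rho>" "\<rho> < 1"
    and 0: "(\<integral>\<eta>. (f \<eta>)\<^sup>2 \<partial>bernoulli_measure \<rho>) = 0"
  shows "f = (\<lambda>\<eta>. 0)"
proof
  fix \<eta>
  let ?w = "\<lambda>S. \<Prod>x\<in>W. if x \<in> S then \<rho> else 1 - \<rho>"
  have pos: "?w S > 0" for S using \<rho> by (intro prod_pos) auto
  have "(\<Sum>S\<in>Pow W. ?w S * (f (\<lambda>x. x \<in> S))\<^sup>2) = 0"
    using 0 local_integral[OF W(1) depends_only_on_compose[OF W(2), of "\<lambda>t. t\<^sup>2"] \<rho>] by simp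
  then have z: "?w S * (f (\<lambda>x. x \<in> S))\<^sup>2 = 0" if "S \<subseteq> W" for S
    using that W pos by (subst (asm) sum_nonneg_eq_0_iff) (auto simp: less_imp_le)
  have "f (\<lambda>x. x \<in> {x\<in>W. \<eta> x}) = 0"
    using pos[of "{x\<in>W. \<eta> x}"] z[of "{x\<in>W. \<eta> x}"] by auto
  also have "f (\<lambda>x. x \<in> {x\<in>W. \<eta> x}) = f \<eta>"
    by (rule depends_only_onD[OF W(2)]) auto
  finally show "f \<eta> = 0" .
qed

text \<open>Each set \<open>S\<close> of occupied sites without \<open>x\<close> is paired with
  \<open>insert x S\<close>; their weights are in the ratio \<open>1 - \<rho>\<close> to
  \<open>\<rho>\<close>, which are the weights in the average.\<close>

lemma integral_site_avg:
  assumes f: "local_fn f" and \<rho>: "0 < \<rho>" "\<rho> < 1"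
  shows "(\<integral>\<eta>. site_avg \<rho> x f \<eta> \<partial>bernoulli_measure \<rho>) = (\<integral>\<eta>. f \<eta> \<partial>bernoulli_measure \<rho>)"
proof -
  obtain V where V: "finite V" "depends_only_on V f" using f unfolding local_fn_def by blast
  define W where "W = V - {x}"
  have W: "finite W" "x \<notin> W" "depends_only_on (insert x W) f"
    using V by (auto simp: W_def elim: depends_only_on_mono)
  have dW: "depends_only_on W (site_avg \<rho> x f)"
    using depends_only_on_site_avg[OF W(3), of x] W(2) by (auto elim: depends_only_on_mono)
  let ?w = "\<lambda>S. \<Prod>x\<in>W. if x \<in> S then \<rho> else 1 - \<rho>"
  have wi: "?w (insert x S) = ?w S" for S using W(2) by (intro prod.cong) auto
  have inj: "inj_on (insert x) (Pow W)" using W(2) by (auto simp: inj_on_def)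
  have dis: "Pow W \<inter> insert x ` Pow W = {}" using W(2) by auto
  have up: "f ((\<lambda>z. z \<in> S)(x := True)) = f (\<lambda>z. z \<in> insert x S)"
    "S \<in> Pow W \<Longrightarrow> f ((\<lambda>z. z \<in> S)(x := False)) = f (\<lambda>z. z \<in> S)" for S
    using W(2) by (auto intro!: arg_cong[where f = f] simp: fun_eq_iff)
  have "(\<integral>\<eta>. f \<eta> \<partial>bernoulli_measure \<rho>)
      = (\<Sum>S\<in>Pow (insert x W). (\<Prod>x\<in>insert x W. if x \<in> S then \<rho> else 1 - \<rho>) * f (\<lambda>x. x \<in> S))"
    using W by (intro local_integral \<rho>) auto
  also have "\<dots> = (\<Sum>S\<in>Pow W. (1 - \<rho>) * ?w S * f (\<lambda>x. x \<in> S))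
       + (\<Sum>S\<in>Pow W. \<rho> * ?w S * f (\<lambda>z. z \<in> insert x S))"
  proof -
    have "(\<Sum>S\<in>insert x ` Pow W. (\<Prod>x\<in>insert x W. if x \<in> S then \<rho> else 1 - \<rho>) * f (\<lambda>x. x \<in> S))
        = (\<Sum>S\<in>Pow W. \<rho> * ?w S * f (\<lambda>z. z \<in> insert x S))"
      unfolding sum.reindex[OF inj] o_def prod.insert[OF W(1,2)] wi by (intro sum.cong) auto
    moreover have "(\<Sum>S\<in>Pow W. (\<Prod>x\<in>insert x W. if x \<in> S then \<rho> else 1 - \<rho>) * f (\<lambda>x. x \<in> S))
        = (\<Sum>S\<in>Pow W. (1 - \<rho>) * ?w S * f (\<lambda>x. x \<in> S))"
      unfolding prod.insert[OF W(1,2)] using W(2) by (intro sum.cong) auto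
    ultimately show ?thesis
      unfolding Pow_insert using W(1) dis by (subst sum.union_disjoint) auto
  qed
  also have "\<dots> = (\<Sum>S\<in>Pow W. ?w S * site_avg \<rho> x f (\<lambda>x. x \<in> S))"
    unfolding sum.distrib[symmetric] site_avg_def by (intro sum.cong) (auto simp: up algebra_simps)
  also have "\<dots> = (\<integral>\<eta>. site_avg \<rho> x f \<eta> \<partial>bernoulli_measure \<rho>)"
    by (rule local_integral[symmetric, OF W(1) dW \<rho>])
  finally show ?thesis by simp
qed

lemma distr_exchange:
  assumes "x \<noteq> y"
  shows "distr (bernoulli_measure \<rho>) (bernoulli_measure \<rho>) (exchange {x, y}) = bernoulli_measure \<rho>"
proof -
  let ?t = "\<lambda>z. if z = x then y else if z = y then x else z"
  have "distr (\<Pi>\<^sub>M i\<in>UNIV. measure_pmf (bernoulli_pmf \<rho>)) (\<Pi>\<^sub>M i\<in>UNIV. measure_pmf (bernoulli_pmf \<rho>))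
     (\<lambda>\<omega>. \<lambda>n\<in>UNIV. \<omega> (?t n)) = (\<Pi>\<^sub>M i\<in>UNIV. measure_pmf (bernoulli_pmf \<rho>))"
    by (rule distr_PiM_reindex) (auto simp: inj_on_def prob_space_measure_pmf split: if_splits)
  moreover have "(\<lambda>\<omega>. \<lambda>n\<in>UNIV. \<omega> (?t n)) = exchange {x, y}"
    using assms by (auto simp: exchange_bond fun_eq_iff)
  ultimately show ?thesis unfolding bernoulli_measure_def by simp
qed

lemma measurable_exchange [measurable]:
  assumes "x \<noteq> y"
  shows "exchange {x, y} \<in> measurable (bernoulli_measure \<rho>) (bernoulli_measure \<rho>)"
proof -
  have "(\<lambda>\<eta>. exchange {x, y} \<eta> z) \<in> measurable (bernoulli_measure \<rho>) (count_space UNIV)" for z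
    using assms by (cases "z = x"; cases "z = y") (auto simp: exchange_bond)
  then have "(\<lambda>\<eta>. exchange {x, y} \<eta> z) \<in> measurable (bernoulli_measure \<rho>) (measure_pmf (bernoulli_pmf \<rho>))" for z
    by (simp cong: measurable_cong_sets)
  then have "exchange {x, y} \<in> measurable (bernoulli_measure \<rho>) (PiM UNIV (\<lambda>_. measure_pmf (bernoulli_pmf \<rho>)))"
    by (intro measurable_PiM_single') auto
  then show ?thesis by (simp add: bernoulli_measure_def)
qed

lemma integrable_exchange:
  fixes f :: "'d::finite config \<Rightarrow> real"
  assumes "x \<noteq> y" "integrable (bernoulli_measure \<rho>) f"
  shows "integrable (bernoulli_measure \<rho>) (\<lambda>\<eta>. f (exchange {x, y} \<eta>))"
  using assms integrable_distr[OF measurable_exchange[OF assms(1)], of \<rho> f] distr_exchange[OF assms(1)]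
  by simp

lemma integral_exchange:
  fixes f :: "'d::finite config \<Rightarrow> real"
  assumes "x \<noteq> y" "f \<in> borel_measurable (bernoulli_measure \<rho>)"
  shows "(\<integral>\<eta>. f (exchange {x, y} \<eta>) \<partial>bernoulli_measure \<rho>) = (\<integral>\<eta>. f \<eta> \<partial>bernoulli_measure \<rho>)"
  using assms integral_distr[OF measurable_exchange[OF assms(1)], of f \<rho>] distr_exchange[OF assms(1)]
  by simp

section \<open>Products of commuting single-site operators\<close>

text \<open>Only \<open>damp a 1\<close>, a partial average at \<open>x\<close>, and the projections \<open>damp 1 0\<close> and \<open>damp 0 1\<close>
  matter; the two-parameter form is closed under composition.\<close>

definition damp :: "real \<Rightarrow> real \<Rightarrow> real \<Rightarrow> 'd::finite site \<Rightarrow> ('d config \<Rightarrow> real) \<Rightarrow> 'd config \<Rightarrow> real" where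
  "damp \<rho> a b x f = (\<lambda>\<eta>. a * (f \<eta> - site_avg \<rho> x f \<eta>) + b * site_avg \<rho> x f \<eta>)"

text \<open>The tensor product of single-site operators; by \<open>damp_commute\<close> the order of
  the fold is irrelevant. For \<open>b = 1\<close> and \<open>a\<close> between 0 and 1 it is
  resampling, where \<open>a x\<close> is the probability of keeping the value at \<open>x\<close>;
  if \<open>a\<close> takes only the values 0 and 1, it is a conditional expectation.\<close>

definition damping :: "real \<Rightarrow> ('d::finite site \<Rightarrow> real) \<Rightarrow> ('d site \<Rightarrow> real) \<Rightarrow> 'd site set \<Rightarrow>
    ('d config \<Rightarrow> real) \<Rightarrow> 'd config \<Rightarrow> real" where
  "damping \<rho> a b M f = Finite_Set.fold (\<lambda>x. damp \<rho> (a x) (b x) x) f M"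

lemma damp_local [intro]: "local_fn f \<Longrightarrow> local_fn (damp \<rho> a b x f)"
  unfolding damp_def by (intro local_fn_arith local_fn_const site_avg_local)

text \<open>Fluctuation and mean at \<open>x\<close> are complementary projections, on whose ranges
  the operator acts by \<open>a\<close> and \<open>b\<close>; composition multiplies these
  eigenvalues.\<close>

lemma damp_damp: "damp \<rho> a b x (damp \<rho> a' b' x f) = damp \<rho> (a * a') (b * b') x f"
  by (simp add: damp_def site_avg_def fun_eq_iff algebra_simps)

lemma damp_commute: "damp \<rho> a b x (damp \<rho> a' b' y f) = damp \<rho> a' b' y (damp \<rho> a b x f)"
proof (cases "x = y")
  case False
  then show ?thesis
    by (simp add: damp_def site_avg_def fun_eq_iff algebra_simps fun_upd_twist[of y x])
qed (simp add: damp_damp mult.commute)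

lemma damp_id [simp]: "damp \<rho> 1 1 x f = f"
  by (simp add: damp_def)

lemma damp_diff: "damp \<rho> a b x (\<lambda>\<eta>. f \<eta> - g \<eta>) = (\<lambda>\<eta>. damp \<rho> a b x f \<eta> - damp \<rho> a b x g \<eta>)"
  by (simp add: damp_def site_avg_def fun_eq_iff algebra_simps)

lemma damp_mult:
  assumes "\<And>\<eta> v. k (\<eta>(x := v)) = k \<eta>"
  shows "damp \<rho> a b x (\<lambda>\<eta>. k \<eta> * f \<eta>) = (\<lambda>\<eta>. k \<eta> * damp \<rho> a b x f \<eta>)"
  by (simp add: damp_def site_avg_def fun_eq_iff algebra_simps assms)

lemma depends_only_on_damp:
  assumes "depends_only_on W f"
  shows "depends_only_on W (damp \<rho> a b x f)" "depends_only_on (W - {x}) (damp \<rho> 0 b x f)"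
proof -
  have d: "depends_only_on (W - {x}) (site_avg \<rho> x f)"
    using assms by (rule depends_only_on_site_avg)
  then have "depends_only_on W (site_avg \<rho> x f)"
    by (rule depends_only_on_mono) auto
  from depends_only_on_compose2[OF assms this, of "\<lambda>s t. a * (s - t) + b * t"]
  show "depends_only_on W (damp \<rho> a b x f)" by (simp add: damp_def)
  from depends_only_on_compose[OF d, of "\<lambda>t. b * t"]
  show "depends_only_on (W - {x}) (damp \<rho> 0 b x f)" by (simp add: damp_def)
qed

lemma damp_exchange:
  assumes "x \<noteq> y"
  shows "damp \<rho> a b x (\<lambda>\<eta>. f (exchange {x, y} \<eta>)) = (\<lambda>\<eta>. damp \<rho> a b y f (exchange {x, y} \<eta>))"
    and "damp \<rho> a b y (\<lambda>\<eta>. f (exchange {x, y} \<eta>)) = (\<lambda>\<eta>. damp \<rho> a b x f (exchange {x, y} \<eta>))"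
    and "z \<noteq> x \<Longrightarrow> z \<noteq> y \<Longrightarrow>
      damp \<rho> a b z (\<lambda>\<eta>. f (exchange {x, y} \<eta>)) = (\<lambda>\<eta>. damp \<rho> a b z f (exchange {x, y} \<eta>))"
proof -
  have "exchange {x, y} (\<eta>(x := v)) = (exchange {x, y} \<eta>)(y := v)"
    "exchange {x, y} (\<eta>(y := v)) = (exchange {x, y} \<eta>)(x := v)"
    "z \<noteq> x \<Longrightarrow> z \<noteq> y \<Longrightarrow> exchange {x, y} (\<eta>(z := v)) = (exchange {x, y} \<eta>)(z := v)" for \<eta> v
    using assms by (auto simp: exchange_bond fun_eq_iff)
  then show "damp \<rho> a b x (\<lambda>\<eta>. f (exchange {x, y} \<eta>)) = (\<lambda>\<eta>. damp \<rho> a b y f (exchange {x, y} \<eta>))"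
    "damp \<rho> a b y (\<lambda>\<eta>. f (exchange {x, y} \<eta>)) = (\<lambda>\<eta>. damp \<rho> a b x f (exchange {x, y} \<eta>))"
    "z \<noteq> x \<Longrightarrow> z \<noteq> y \<Longrightarrow>
      damp \<rho> a b z (\<lambda>\<eta>. f (exchange {x, y} \<eta>)) = (\<lambda>\<eta>. damp \<rho> a b z f (exchange {x, y} \<eta>))"
    by (simp_all add: damp_def site_avg_def)
qed

interpretation damping: comp_fun_commute "\<lambda>x. damp \<rho> (a x) (b x) x"
  by standard (simp add: fun_eq_iff damp_commute)

lemma damping_empty [simp]: "damping \<rho> a b {} f = f"
  by (simp add: damping_def)

lemma damping_insert:
  assumes "finite M" "x \<notin> M"
  shows "damping \<rho> a b (insert x M) f = damp \<rho> (a x) (b x) x (damping \<rho> a b M f)"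
  unfolding damping_def using damping.fold_insert[OF assms] .

lemma damping_commute:
  assumes "finite M"
  shows "damp \<rho> a' b' x (damping \<rho> a b M f) = damping \<rho> a b M (damp \<rho> a' b' x f)"
  using assms by induction (simp_all add: damping_insert damp_commute[of _ a' b'])

lemma damping_local [intro]: "finite M \<Longrightarrow> local_fn f \<Longrightarrow> local_fn (damping \<rho> a b M f)"
  by (induction M rule: finite_induct) (auto simp: damping_insert)

lemma damping_cong:
  assumes "finite M" "\<And>x. x \<in> M \<Longrightarrow> a x = a' x" "\<And>x. x \<in> M \<Longrightarrow> b x = b' x"
  shows "damping \<rho> a b M f = damping \<rho> a' b' M f"
  using assms by (induction M rule: finite_induct) (auto simp: damping_insert)

lemma damping_damping:
  assumes "finite M"
  shows "damping \<rho> a b M (damping \<rho> a' b' M f) = damping \<rho> (\<lambda>x. a x * a' x) (\<lambda>x. b x * b' x) M f"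
  using assms
  by (induction M arbitrary: f rule: finite_induct)
     (simp_all add: damping_insert damping_commute[symmetric] damp_damp mult.commute)

lemma damping_id:
  assumes "finite M" "\<And>x. x \<in> M \<Longrightarrow> a x = 1" "\<And>x. x \<in> M \<Longrightarrow> b x = 1"
  shows "damping \<rho> a b M f = f"
  using assms by (induction M rule: finite_induct) (auto simp: damping_insert)

lemma damping_diff:
  assumes "finite M"
  shows "damping \<rho> a b M (\<lambda>\<eta>. f \<eta> - g \<eta>) = (\<lambda>\<eta>. damping \<rho> a b M f \<eta> - damping \<rho> a b M g \<eta>)"
  using assms by (induction M rule: finite_induct) (simp_all add: damping_insert damp_diff)

text \<open>At each site of \<open>M\<close> either \<open>k\<close> is constant in that variable
  and leaves the average, or the factor of the damping is the identity. In this way rates pass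
  through the operators.\<close>

lemma damping_mult:
  assumes "finite M" "depends_only_on A k" "\<And>x. x \<in> M \<inter> A \<Longrightarrow> a x = 1 \<and> b x = 1"
  shows "damping \<rho> a b M (\<lambda>\<eta>. k \<eta> * f \<eta>) = (\<lambda>\<eta>. k \<eta> * damping \<rho> a b M f \<eta>)"
  using assms(1,3)
proof (induction M rule: finite_induct)
  case (insert x M)
  show ?case
  proof (cases "x \<in> A")
    case False
    then have "k (\<eta>(x := v)) = k \<eta>" for \<eta> v
      by (intro depends_only_onD[OF assms(2)]) auto
    then show ?thesis using insert by (simp add: damping_insert damp_mult)
  qed (use insert in \<open>simp add: damping_insert\<close>)
qed simp

lemma depends_only_on_damping:
  assumes "finite M" "depends_only_on W f"
  shows "depends_only_on (W - {x \<in> M. a x = 0}) (damping \<rho> a b M f)"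
  using assms(1)
proof (induction M rule: finite_induct)
  case (insert x M)
  let ?W = "W - {z \<in> M. a z = 0}"
  show ?case
  proof (cases "a x = 0")
    case True
    have "depends_only_on (?W - {x}) (damp \<rho> 0 (b x) x (damping \<rho> a b M f))"
      by (rule depends_only_on_damp(2)[OF insert.IH])
    moreover have "?W - {x} = W - {z \<in> insert x M. a z = 0}" using True by auto
    ultimately show ?thesis using insert True by (simp add: damping_insert)
  next
    case False
    have "depends_only_on ?W (damp \<rho> (a x) (b x) x (damping \<rho> a b M f))"
      by (rule depends_only_on_damp(1)[OF insert.IH])
    moreover have "?W = W - {z \<in> insert x M. a z = 0}" using False by auto
    ultimately show ?thesis using insert by (simp add: damping_insert)
  qed
qed (use assms in simp)

text \<open>The exchange carries the factor at \<open>x\<close> to \<open>y\<close> and conversely,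
  so equal parameters at the endpoints leave the product invariant. Unequal ones are the source of
  the commutator treated in \<open>damping_split\<close>.\<close>

lemma damping_exchange:
  assumes M: "finite M" "x \<in> M" "y \<in> M" and "x \<noteq> y" and eq: "a x = a y" "b x = b y"
  shows "damping \<rho> a b M (\<lambda>\<eta>. f (exchange {x, y} \<eta>)) = (\<lambda>\<eta>. damping \<rho> a b M f (exchange {x, y} \<eta>))"
proof -
  have *: "damping \<rho> a b N (\<lambda>\<eta>. f (exchange {x, y} \<eta>)) = (\<lambda>\<eta>. damping \<rho> a b N f (exchange {x, y} \<eta>))"
    if "finite N" "x \<notin> N" "y \<notin> N" for N
    using that
  proof (induction N rule: finite_induct)
    case (insert z N)
    then have "z \<noteq> x" "z \<noteq> y" by auto
    with insert show ?case
      by (simp add: damping_insert damp_exchange(3)[OF \<open>x \<noteq> y\<close>])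
  qed simp
  define N where "N = M - {x, y}"
  have MN: "M = insert x (insert y N)" "finite (insert y N)" "x \<notin> insert y N" "finite N" "y \<notin> N" "x \<notin> N"
    using assms by (auto simp: N_def)
  show ?thesis
    unfolding MN(1) damping_insert[OF MN(2,3)] damping_insert[OF MN(4,5)]
    by (simp add: *[OF MN(4,6,5)] damp_exchange(1,2)[OF \<open>x \<noteq> y\<close>] eq damp_commute)
qed

lemma damping_pi_bond:
  assumes "finite M" "x \<in> M" "y \<in> M" "x \<noteq> y" "a x = a y" "b x = b y"
  shows "damping \<rho> a b M (pi_bond {x, y} f) = pi_bond {x, y} (damping \<rho> a b M f)"
  unfolding pi_bond_def damping_diff[OF assms(1)] damping_exchange[OF assms] ..

section \<open>Spectral bounds\<close>

locale bernoulli_density =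
  fixes \<rho> :: real
  assumes density: "0 < \<rho>" "\<rho> < 1"
begin

definition ip :: "('d::finite config \<Rightarrow> real) \<Rightarrow> ('d config \<Rightarrow> real) \<Rightarrow> real" where
  "ip f g = (\<integral>\<eta>. f \<eta> * g \<eta> \<partial>bernoulli_measure \<rho>)"

lemma ip_commute: "ip f g = ip g f"
  by (simp add: ip_def mult.commute)

lemma ip_diff_left:
  "local_fn f \<Longrightarrow> local_fn g \<Longrightarrow> local_fn h \<Longrightarrow> ip (\<lambda>\<eta>. f \<eta> - g \<eta>) h = ip f h - ip g h"
  unfolding ip_def left_diff_distrib
  by (intro Bochner_Integration.integral_diff local_integrable local_fn_arith)

lemma ip_add_left:
  "local_fn f \<Longrightarrow> local_fn g \<Longrightarrow> local_fn h \<Longrightarrow> ip (\<lambda>\<eta>. f \<eta> + g \<eta>) h = ip f h + ip g h"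
  unfolding ip_def distrib_right
  by (intro Bochner_Integration.integral_add local_integrable local_fn_arith)

lemma ip_scale_left: "ip (\<lambda>\<eta>. k * f \<eta>) g = k * ip f g"
  by (simp add: ip_def mult.assoc)

lemma ip_mono:
  assumes "local_fn f" "local_fn g" "local_fn f'" "local_fn g'" "\<And>\<eta>. f \<eta> * g \<eta> \<le> f' \<eta> * g' \<eta>"
  shows "ip f g \<le> ip f' g'"
  unfolding ip_def using assms by (intro integral_mono local_integrable local_fn_arith)

lemma ip_self_nonneg: "0 \<le> ip f f"
  by (simp add: ip_def)

lemma ip_exchange:
  assumes "local_fn f" "local_fn g" "x \<noteq> y"
  shows "ip (\<lambda>\<eta>. f (exchange {x, y} \<eta>)) (\<lambda>\<eta>. g (exchange {x, y} \<eta>)) = ip f g"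
  unfolding ip_def using assms
  by (intro integral_exchange[of x y "\<lambda>\<eta>. f \<eta> * g \<eta>"])
     (auto intro!: borel_measurable_integrable local_integrable)

text \<open>The average no longer depends on \<open>x\<close>, so it leaves a second average at
  \<open>x\<close>. The symmetry of all dampings rests on this.\<close>

lemma ip_site_avg:
  assumes "local_fn f" "local_fn g"
  shows "ip (site_avg \<rho> x f) g = ip (site_avg \<rho> x f) (site_avg \<rho> x g)"
proof -
  have "site_avg \<rho> x (\<lambda>\<eta>. site_avg \<rho> x f \<eta> * g \<eta>) = (\<lambda>\<eta>. site_avg \<rho> x f \<eta> * site_avg \<rho> x g \<eta>)"
    by (simp add: site_avg_def fun_eq_iff algebra_simps)
  then show ?thesis
    unfolding ip_def using integral_site_avg[of "\<lambda>\<eta>. site_avg \<rho> x f \<eta> * g \<eta>" \<rho> x] density assms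
    by (simp add: local_fn_arith site_avg_local)
qed

lemma ip_damp:
  assumes "local_fn f" "local_fn g"
  shows "ip (damp \<rho> a b x f) g = ip f (damp \<rho> a b x g)"
proof -
  have "ip (damp \<rho> a b x f) g = a * ip f g + (b - a) * ip (site_avg \<rho> x f) g" if "local_fn f" "local_fn g" for f g
  proof -
    have "damp \<rho> a b x f = (\<lambda>\<eta>. a * f \<eta> + (b - a) * site_avg \<rho> x f \<eta>)"
      by (simp add: damp_def fun_eq_iff algebra_simps)
    then show ?thesis
      using that by (simp add: ip_add_left ip_scale_left local_fn_arith site_avg_local)
  qed
  from this[OF assms] this[OF assms(2,1)] show ?thesis
    using ip_site_avg[OF assms, of x] ip_site_avg[OF assms(2,1), of x] by (simp add: ip_commute)
qed

lemma ip_damping: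
  assumes "finite M" "local_fn f" "local_fn g"
  shows "ip (damping \<rho> a b M f) g = ip f (damping \<rho> a b M g)"
  using assms
  by (induction M arbitrary: f g rule: finite_induct)
     (simp_all add: damping_insert ip_damp damping_local damp_local damping_commute)

text \<open>The orthogonal splitting of \<open>f\<close> at the single site \<open>x\<close> into
  fluctuation \<open>damp \<rho> 1 0 x f\<close> and mean \<open>damp \<rho> 0 1 x f\<close>; it is
  the induction step of the spectral decomposition.\<close>

lemma ip_damping_insert:
  assumes "finite M" "x \<notin> M" "local_fn f"
  shows "ip (damping \<rho> a b (insert x M) f) f
    = a x * ip (damping \<rho> a b M (damp \<rho> 1 0 x f)) (damp \<rho> 1 0 x f)
    + b x * ip (damping \<rho> a b M (damp \<rho> 0 1 x f)) (damp \<rho> 0 1 x f)"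
proof -
  let ?g = "damping \<rho> a b M f"
  have l: "local_fn ?g" using assms by blast
  \<comment> \<open>For \<open>s\<close>, \<open>t\<close> in {0, 1} the operator is a self-adjoint
    projection, so a second copy of it can be moved to the other factor.\<close>
  have *: "ip (damp \<rho> s t x ?g) f = ip (damping \<rho> a b M (damp \<rho> s t x f)) (damp \<rho> s t x f)"
    if "s * s = s" "t * t = t" for s t
  proof -
    have "damp \<rho> s t x ?g = damp \<rho> s t x (damp \<rho> s t x ?g)" by (simp add: damp_damp that)
    then have "ip (damp \<rho> s t x ?g) f = ip (damp \<rho> s t x ?g) (damp \<rho> s t x f)"
      using ip_damp[of "damp \<rho> s t x ?g" f s t x] l assms by (simp add: damp_local)
    then show ?thesis by (simp add: damping_commute assms)
  qed
  have "damp \<rho> (a x) (b x) x ?g = (\<lambda>\<eta>. a x * damp \<rho> 1 0 x ?g \<eta> + b x * damp \<rho> 0 1 x ?g \<eta>)"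
    by (simp add: damp_def fun_eq_iff)
  then have "ip (damping \<rho> a b (insert x M) f) f = a x * ip (damp \<rho> 1 0 x ?g) f + b x * ip (damp \<rho> 0 1 x ?g) f"
    using l assms by (simp add: damping_insert ip_add_left ip_scale_left local_fn_arith damp_local)
  then show ?thesis using *[of 1 0] *[of 0 1] by simp
qed

text \<open>All operators \<open>damping \<rho> (a j) (b j) M\<close> are diagonal in the decomposition of a local function
  into components indexed by the set \<open>S\<close> of sites on which they really depend.\<close>

lemma spectral_bound:
  assumes "finite M" "local_fn f"
    and "\<And>S. S \<subseteq> M \<Longrightarrow> (\<Sum>j\<in>J. w j * (\<Prod>x\<in>M. if x \<in> S then a j x else b j x)) \<le> K"
  shows "(\<Sum>j\<in>J. w j * ip (damping \<rho> (a j) (b j) M f) f) \<le> K * ip f f"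
  using assms
proof (induction M arbitrary: w f rule: finite_induct)
  case empty
  then have "sum w J \<le> K" by simp
  then have "sum w J * ip f f \<le> K * ip f f" by (intro mult_right_mono ip_self_nonneg)
  then show ?case by (simp add: sum_distrib_right)
next
  case (insert x M)
  have pr: "(\<Prod>z\<in>M. if z \<in> insert x S then a j z else b j z) = (\<Prod>z\<in>M. if z \<in> S then a j z else b j z)" for S j
    using insert(2) by (intro prod.cong) auto
  \<comment> \<open>On the part fluctuating at \<open>x\<close> the eigenvalue \<open>a j x\<close>
    is absorbed into the weight and \<open>S\<close> becomes \<open>insert x S\<close>; on the mean
    part \<open>b j x\<close> is absorbed and \<open>S\<close> stays.\<close>
  have 1: "(\<Sum>j\<in>J. (w j * a j x) * ip (damping \<rho> (a j) (b j) M (damp \<rho> 1 0 x f)) (damp \<rho> 1 0 x f))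
      \<le> K * ip (damp \<rho> 1 0 x f) (damp \<rho> 1 0 x f)"
  proof (rule insert.IH)
    fix S assume "S \<subseteq> M"
    with insert.prems(2)[of "insert x S"] insert(1,2) pr[of S]
    show "(\<Sum>j\<in>J. w j * a j x * (\<Prod>x\<in>M. if x \<in> S then a j x else b j x)) \<le> K"
      by (simp add: mult.assoc subset_insertI2)
  qed (use insert in blast)
  have 2: "(\<Sum>j\<in>J. (w j * b j x) * ip (damping \<rho> (a j) (b j) M (damp \<rho> 0 1 x f)) (damp \<rho> 0 1 x f))
      \<le> K * ip (damp \<rho> 0 1 x f) (damp \<rho> 0 1 x f)"
  proof (rule insert.IH)
    fix S assume "S \<subseteq> M"
    with insert.prems(2)[of S] insert(1,2)
    have "(\<Sum>j\<in>J. w j * ((if x \<in> S then a j x else b j x) * (\<Prod>x\<in>M. if x \<in> S then a j x else b j x))) \<le> K"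
      by (simp add: subset_insertI2)
    moreover have "x \<notin> S" using \<open>S \<subseteq> M\<close> insert(2) by auto
    ultimately show "(\<Sum>j\<in>J. w j * b j x * (\<Prod>x\<in>M. if x \<in> S then a j x else b j x)) \<le> K"
      by (simp add: mult.assoc)
  qed (use insert in blast)
  have "ip f f = ip (damp \<rho> 1 0 x f) (damp \<rho> 1 0 x f) + ip (damp \<rho> 0 1 x f) (damp \<rho> 0 1 x f)"
    using ip_damping_insert[of "{}" x f "\<lambda>_. 1" "\<lambda>_. 1"] insert by (simp add: damping_insert)
  then show ?case
    using 1 2 insert by (simp add: ip_damping_insert distrib_left sum.distrib mult.assoc)
qed

lemma spectral_mono:
  assumes "finite M" "local_fn f"
    and "\<And>x. x \<in> M \<Longrightarrow> 0 \<le> a x \<and> a x \<le> a' x" "\<And>x. x \<in> M \<Longrightarrow> 0 \<le> b x \<and> b x \<le> b' x"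
  shows "ip (damping \<rho> a b M f) f \<le> ip (damping \<rho> a' b' M f) f"
proof -
  \<comment> \<open>The difference of the two forms is a signed combination with weights 1 and -1,
    to be bounded with \<open>K = 0\<close>.\<close>
  have "(\<Sum>j\<in>(UNIV :: bool set). (if j then 1 else - 1) *
      ip (damping \<rho> (if j then a else a') (if j then b else b') M f) f) \<le> 0 * ip f f"
  proof (rule spectral_bound[OF assms(1,2)])
    fix S assume "S \<subseteq> M"
    have "(\<Prod>x\<in>M. if x \<in> S then a x else b x) \<le> (\<Prod>x\<in>M. if x \<in> S then a' x else b' x)"
      using assms by (intro prod_mono) auto
    then show "(\<Sum>j\<in>UNIV. (if j then 1 else - 1) *
        (\<Prod>x\<in>M. if x \<in> S then (if j then a else a') x else (if j then b else b') x)) \<le> 0"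
      by (simp add: UNIV_bool)
  qed
  then show ?thesis by (simp add: UNIV_bool)
qed

lemma ip_damping_self:
  assumes "finite M" "local_fn f"
  shows "ip (damping \<rho> a b M f) (damping \<rho> a b M f) = ip (damping \<rho> (\<lambda>x. a x * a x) (\<lambda>x. b x * b x) M f) f"
  using assms by (simp add: ip_damping[symmetric] damping_local damping_damping)

lemma damping_contraction:
  assumes "finite M" "local_fn f"
    and "\<And>x. x \<in> M \<Longrightarrow> 0 \<le> a x \<and> a x \<le> 1" "\<And>x. x \<in> M \<Longrightarrow> 0 \<le> b x \<and> b x \<le> 1"
  shows "ip (damping \<rho> a b M f) (damping \<rho> a b M f) \<le> ip f f"
proof -
  have "ip (damping \<rho> (\<lambda>x. a x * a x) (\<lambda>x. b x * b x) M f) f \<le> ip (damping \<rho> (\<lambda>_. 1) (\<lambda>_. 1) M f) f"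
    using assms by (intro spectral_mono) (auto simp: mult_le_one)
  then show ?thesis
    using assms by (simp add: ip_damping_self damping_id)
qed

end

section \<open>Boxes and bonds\<close>

definition sup_norm :: "'d::finite site \<Rightarrow> nat" where
  "sup_norm x = Max (range (\<lambda>i. nat \<bar>x $ i\<bar>))"

definition lattice_box :: "nat \<Rightarrow> 'd::finite site set" where
  "lattice_box m = {x. sup_norm x \<le> m}"

lemma sup_norm_le_iff: "sup_norm x \<le> m \<longleftrightarrow> (\<forall>i. \<bar>x $ i\<bar> \<le> int m)"
  unfolding sup_norm_def by (subst Max_le_iff) (auto simp: nat_le_iff)

lemma mem_lattice_box: "x \<in> lattice_box m \<longleftrightarrow> (\<forall>i. \<bar>x $ i\<bar> \<le> int m)"
  by (simp add: lattice_box_def sup_norm_le_iff)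

lemma lattice_box_mono: "m \<le> n \<Longrightarrow> lattice_box m \<subseteq> lattice_box n"
  by (auto simp: lattice_box_def)

lemma bij_betw_lattice_box:
  "bij_betw vec_nth (lattice_box m :: 'd::finite site set) (\<Pi>\<^sub>E i\<in>UNIV. {- int m..int m})"
proof -
  have eq: "lattice_box m = {x :: 'd site. \<forall>i. x $ i \<in> {- int m..int m}}"
    unfolding set_eq_iff mem_lattice_box mem_Collect_eq by (simp add: abs_le_iff minus_le_iff[of _ "int m"] conj_commute)
  show ?thesis
    unfolding eq by (rule bij_betwI[where g = vec_lambda]) (simp_all add: PiE_iff Pi_def fun_eq_iff)
qed

lemma finite_lattice_box [simp]: "finite (lattice_box m :: 'd::finite site set)"
  unfolding bij_betw_finite[OF bij_betw_lattice_box] by (intro finite_PiE) auto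

lemma card_lattice_box: "card (lattice_box m :: 'd::finite site set) = (2 * m + 1) ^ CARD('d)"
proof -
  have "nat (2 * int m + 1) = 2 * m + 1" by simp
  then show ?thesis
    using bij_betw_same_card[OF bij_betw_lattice_box[of m, where ?'d = 'd]]
    by (simp add: card_PiE del: nat_add_distrib)
qed

lemma abs_component_le_site_norm: "real_of_int \<bar>x $ i\<bar> \<le> site_norm x"
  using component_le_norm_cart[of "(\<chi> i. real_of_int (x $ i)) :: real ^ 'a" i]
  by (simp add: site_norm_def)

lemma sup_norm_le_site_norm:
  assumes "site_norm (x - y) \<le> real k"
  shows "sup_norm x \<le> sup_norm y + k"
  unfolding sup_norm_le_iff
proof
  fix i
  have "real_of_int \<bar>(x - y) $ i\<bar> \<le> real k" using abs_component_le_site_norm[of "x - y" i] assms by simp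
  then have "\<bar>(x - y) $ i\<bar> \<le> int k" by linarith
  moreover have "\<bar>y $ i\<bar> \<le> int (sup_norm y)" using sup_norm_le_iff[of y "sup_norm y"] by simp
  ultimately show "\<bar>x $ i\<bar> \<le> int (sup_norm y + k)" by simp
qed

lemma site_norm_minus: "site_norm (x - y) = site_norm (y - x)"
proof -
  have "(\<chi> i. real_of_int ((x - y) $ i)) = - ((\<chi> i. real_of_int ((y - x) $ i)) :: real ^ 'a)"
    by (simp add: vec_eq_iff)
  then show ?thesis by (simp only: site_norm_def norm_minus_cancel)
qed

lemma site_norm_axis: "site_norm (axis i 1 :: 'd::finite site) = 1"
proof -
  have "(\<chi> j. real_of_int ((axis i 1 :: 'd site) $ j)) = (axis i 1 :: real ^ 'd)"
    by (simp add: vec_eq_iff axis_def)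
  then show ?thesis by (simp add: site_norm_def)
qed

lemma axis_neighbour:
  fixes x :: "'d::finite site"
  shows "site_norm (x - (x + axis i 1)) = 1" "x \<noteq> x + axis i 1"
    "sup_norm (x + axis i 1) \<le> sup_norm x + 1" "sup_norm x \<le> sup_norm (x + axis i 1) + 1"
proof -
  show n: "site_norm (x - (x + axis i 1)) = 1"
    using site_norm_minus[of "x + axis i 1" x] by (simp add: site_norm_axis)
  show "sup_norm x \<le> sup_norm (x + axis i 1) + 1"
    using n by (intro sup_norm_le_site_norm) simp
  show "sup_norm (x + axis i 1) \<le> sup_norm x + 1"
    using n site_norm_minus[of x "x + axis i 1"] by (intro sup_norm_le_site_norm) simp
  show "x \<noteq> x + axis i 1" by simp
qed

lemma lattice_box_subset_interior: "lattice_box m \<subseteq> lattice_interior (lattice_box (Suc m))"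
  unfolding lattice_interior_def inner_boundary_def
proof safe
  fix x :: "'a site" assume x: "x \<in> lattice_box m"
  then show "x \<in> lattice_box (Suc m)" by (simp add: lattice_box_def)
  fix y assume "y \<notin> lattice_box (Suc m)" "site_norm (x - y) = 1"
  then show False
    using sup_norm_le_site_norm[of y x 1] site_norm_minus[of x y] x by (simp add: lattice_box_def)
qed

lemma closed_bondsE:
  assumes "b \<in> closed_bonds (lattice_box m)"
  obtains x y where "b = {x, y}" "x \<noteq> y" "site_norm (x - y) = 1" "sup_norm x \<le> m"
    "sup_norm y \<le> sup_norm x + 1" "sup_norm x \<le> sup_norm y + 1"
proof -
  obtain x i where "b = {x, x + axis i 1}" "sup_norm x \<le> m"
    using assms unfolding closed_bonds_def lattice_box_def by auto
  then show thesis by (intro that[of x "x + axis i 1"] axis_neighbour)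
qed

lemma closed_bonds_image: "closed_bonds (lattice_box m) = (\<lambda>(x, i). {x, x + axis i 1}) ` (lattice_box m \<times> UNIV)"
  unfolding closed_bonds_def by auto

lemma finite_closed_bonds [simp]: "finite (closed_bonds (lattice_box m))"
  unfolding closed_bonds_image by simp

lemma closed_bonds_mono: "m \<le> n \<Longrightarrow> closed_bonds (lattice_box m) \<subseteq> closed_bonds (lattice_box n)"
  unfolding closed_bonds_image using lattice_box_mono by blast

text \<open>A site lies in at most two bonds of each direction, once as lower and once as upper
  endpoint. The radius \<open>Suc m\<close> is there because upper endpoints may leave the
  box.\<close>

lemma sum_closed_bonds_le:
  fixes g :: "'d::finite site \<Rightarrow> real"
  assumes g: "\<And>z. 0 \<le> g z" and W: "finite W" "lattice_box (Suc m) \<subseteq> W"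
  shows "(\<Sum>b\<in>closed_bonds (lattice_box m). \<Sum>z\<in>b. g z) \<le> 2 * real CARD('d) * (\<Sum>z\<in>W. g z)"
proof -
  have up: "(\<Sum>x\<in>lattice_box m. g (x + axis i 1)) \<le> (\<Sum>z\<in>W. g z)" for i
  proof -
    have "(\<Sum>x\<in>lattice_box m. g (x + axis i 1)) = (\<Sum>z\<in>(\<lambda>x. x + axis i 1) ` lattice_box m. g z)"
      by (subst sum.reindex) (auto simp: inj_on_def)
    also have "\<dots> \<le> (\<Sum>z\<in>W. g z)"
    proof (rule sum_mono2)
      show "(\<lambda>x. x + axis i 1) ` lattice_box m \<subseteq> W"
      proof (rule image_subsetI)
        fix x :: "'d site" assume "x \<in> lattice_box m"
        then have "x + axis i 1 \<in> lattice_box (Suc m)" using axis_neighbour(3)[of x i] by (simp add: lattice_box_def)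
        then show "x + axis i 1 \<in> W" using W(2) by blast
      qed
    qed (use W g in auto)
    finally show ?thesis .
  qed
  have low: "(\<Sum>x\<in>lattice_box m. g x) \<le> (\<Sum>z\<in>W. g z)"
    using W g lattice_box_mono[of m "Suc m"] by (intro sum_mono2) auto
  have "(\<Sum>b\<in>closed_bonds (lattice_box m). \<Sum>z\<in>b. g z)
      \<le> (\<Sum>(x, i)\<in>lattice_box m \<times> UNIV. \<Sum>z\<in>{x, x + axis i 1}. g z)"
    unfolding closed_bonds_image
    using sum_image_le[of "lattice_box m \<times> UNIV" "\<lambda>b. \<Sum>z\<in>b. g z" "\<lambda>(x, i). {x, x + axis i (1::int)}"] g
    by (auto simp: sum_nonneg o_def case_prod_unfold)
  also have "\<dots> = (\<Sum>x\<in>lattice_box m. \<Sum>i\<in>UNIV. g x + g (x + axis i 1))"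
    unfolding sum.cartesian_product[symmetric] using axis_neighbour(2) by simp
  also have "\<dots> = (\<Sum>i\<in>(UNIV :: 'd set). (\<Sum>x\<in>lattice_box m. g x) + (\<Sum>x\<in>lattice_box m. g (x + axis i 1)))"
    by (subst sum.swap) (simp add: sum.distrib)
  also have "\<dots> \<le> (\<Sum>i\<in>(UNIV :: 'd set). (\<Sum>z\<in>W. g z) + (\<Sum>z\<in>W. g z))"
    by (intro sum_mono add_mono up low)
  finally show ?thesis by simp
qed

section \<open>The damped test function\<close>

text \<open>If each \<open>x\<close> fails independently with probability \<open>1 - p x\<close>, the left side is the probability of
  at most one failure.\<close>

lemma sum_single_failure_le_1:
  fixes p :: "'a \<Rightarrow> real"
  assumes "finite S" "\<And>x. x \<in> S \<Longrightarrow> 0 \<le> p x \<and> p x \<le> 1"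
  shows "(\<Sum>y\<in>S. (1 - p y) * (\<Prod>x\<in>S - {y}. p x)) + (\<Prod>x\<in>S. p x) \<le> 1"
  using assms
proof (induction S rule: finite_induct)
  case (insert z S)
  have pz: "0 \<le> p z" "p z \<le> 1" using insert by auto
  let ?P = "\<Prod>x\<in>S. p x" and ?F = "\<Sum>y\<in>S. (1 - p y) * (\<Prod>x\<in>S - {y}. p x)"
  have P: "?P \<le> 1" using insert by (intro prod_le_1) auto
  have IH: "?F + ?P \<le> 1" using insert by auto
  have "(\<Prod>x\<in>insert z S - {y}. p x) = p z * (\<Prod>x\<in>S - {y}. p x)" if "y \<in> S" for y
  proof -
    have "insert z S - {y} = insert z (S - {y})" using that insert by auto
    then show ?thesis using insert by simp
  qed
  \<comment> \<open>Conditioning on \<open>z\<close>: if it fails, all others must succeed; if it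
    succeeds, at most one of the others may fail.\<close>
  then have "(\<Sum>y\<in>insert z S. (1 - p y) * (\<Prod>x\<in>insert z S - {y}. p x)) + (\<Prod>x\<in>insert z S. p x)
      = (1 - p z) * ?P + p z * (?F + ?P)"
    using insert by (simp add: sum_distrib_left algebra_simps)
  also have "\<dots> \<le> (1 - p z) * 1 + p z * 1"
    using pz P IH by (intro add_mono mult_left_mono) auto
  finally show ?case by simp
qed simp

context bernoulli_density
begin

text \<open>\<open>g y\<close> is the fluctuation of \<open>u\<close> at \<open>y\<close>, damped by
  \<open>p\<close> at the other sites. On the component indexed by \<open>S\<close> its squared norm
  has eigenvalue 0 if \<open>y\<close> is not in \<open>S\<close>, and otherwise the product of the
  squares of \<open>p\<close> over \<open>S - {y}\<close>. Since these squares are at most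
  \<open>p\<close>, the sum over \<open>y\<close> is bounded by the probability that exactly one
  site of \<open>S\<close> fails.\<close>

lemma sum_influence_le:
  assumes W: "finite W" and u: "local_fn u" and p: "\<And>x. x \<in> W \<Longrightarrow> 0 \<le> p x \<and> p x \<le> 1"
  defines "g \<equiv> \<lambda>y. damping \<rho> (p(y := 1)) ((\<lambda>_. 1)(y := 0)) W u"
  shows "(\<Sum>y\<in>W. (1 - p y) * ip (g y) (g y)) \<le> ip u u"
proof -
  let ?a = "\<lambda>y x. (p(y := 1)) x * (p(y := 1)) x" and ?b = "\<lambda>y x. ((\<lambda>_. 1::real)(y := 0)) x * ((\<lambda>_. 1)(y := 0)) x"
  have "(\<Sum>y\<in>W. (1 - p y) * ip (damping \<rho> (?a y) (?b y) W u) u) \<le> 1 * ip u u"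
  proof (rule spectral_bound[OF W u])
    fix S assume S: "S \<subseteq> W"
    have fS: "finite S" using S W finite_subset by blast
    have le: "(1 - p y) * (\<Prod>x\<in>W. if x \<in> S then ?a y x else ?b y x)
        \<le> (if y \<in> S then (1 - p y) * (\<Prod>x\<in>S - {y}. p x) else 0)" if y: "y \<in> W" for y
    proof (cases "y \<in> S")
      case True
      have "(\<Prod>x\<in>W. if x \<in> S then ?a y x else ?b y x) = (\<Prod>x\<in>S - {y}. if x \<in> S then ?a y x else ?b y x)"
      proof (rule prod.mono_neutral_right)
        show "\<forall>x\<in>W - (S - {y}). (if x \<in> S then ?a y x else ?b y x) = 1"
        proof
          fix x assume "x \<in> W - (S - {y})"
          then consider "x = y" | "x \<noteq> y" "x \<notin> S" by blast
          then show "(if x \<in> S then ?a y x else ?b y x) = 1"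
            by cases (use True in simp_all)
        qed
      qed (use S W in auto)
      also have "\<dots> \<le> (\<Prod>x\<in>S - {y}. p x)"
      proof (rule prod_mono)
        fix x assume x: "x \<in> S - {y}"
        then have "0 \<le> p x" "p x \<le> 1" using S p by auto
        with x show "0 \<le> (if x \<in> S then ?a y x else ?b y x) \<and> (if x \<in> S then ?a y x else ?b y x) \<le> p x"
          by (simp add: mult_left_le)
      qed
      finally show ?thesis using True p[OF y] by (simp add: mult_left_mono)
    next
      case False
      then have "(\<Prod>x\<in>W. if x \<in> S then ?a y x else ?b y x) = 0"
        using W y by (intro prod_zero) auto
      then show ?thesis using False by simp
    qed
    have "(\<Sum>y\<in>W. (1 - p y) * (\<Prod>x\<in>W. if x \<in> S then ?a y x else ?b y x))
        \<le> (\<Sum>y\<in>W. if y \<in> S then (1 - p y) * (\<Prod>x\<in>S - {y}. p x) else 0)"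
      by (intro sum_mono le)
    also have "\<dots> = (\<Sum>y\<in>S. (1 - p y) * (\<Prod>x\<in>S - {y}. p x))"
      using S W by (simp add: sum.If_cases Int_absorb1)
    also have "\<dots> \<le> 1 - (\<Prod>x\<in>S. p x)"
      using sum_single_failure_le_1[OF fS, of p] p S by fastforce
    also have "\<dots> \<le> 1" using p S by (simp add: prod_nonneg subset_iff)
    finally show "(\<Sum>y\<in>W. (1 - p y) * (\<Prod>x\<in>W. if x \<in> S then ?a y x else ?b y x)) \<le> 1" .
  qed
  then show ?thesis unfolding g_def ip_damping_self[OF W u] by simp
qed

text \<open>Giving both endpoints of a bond the damping of one of them makes the operator commute with the
  exchange; the defect is the influence of the other endpoint.\<close>

lemma damping_split:
  assumes W: "finite W" "x \<in> W" "y \<in> W" "x \<noteq> y"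
  shows "pi_bond {x, y} (damping \<rho> p (\<lambda>_. 1) W u) =
    (\<lambda>\<eta>. damping \<rho> (p(y := p x)) (\<lambda>_. 1) W (pi_bond {x, y} u) \<eta>
      + (p y - p x) * pi_bond {x, y} (damping \<rho> (p(y := 1)) ((\<lambda>_. 1)(y := 0)) W u) \<eta>)"
proof -
  define N where "N = W - {y}"
  have WN: "W = insert y N" "finite N" "y \<notin> N" using W by (auto simp: N_def)
  have eqN: "damping \<rho> (p(y := t)) ((\<lambda>_. 1)(y := s)) N u = damping \<rho> p (\<lambda>_. 1) N u"
    "damping \<rho> (p(y := t)) (\<lambda>_. 1) N u = damping \<rho> p (\<lambda>_. 1) N u" for s t
    using WN by (auto intro!: damping_cong)
  have "damping \<rho> p (\<lambda>_. 1) W u = (\<lambda>\<eta>. damping \<rho> (p(y := p x)) (\<lambda>_. 1) W u \<eta>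
      + (p y - p x) * damping \<rho> (p(y := 1)) ((\<lambda>_. 1)(y := 0)) W u \<eta>)"
    unfolding WN(1) damping_insert[OF WN(2,3)] eqN
    by (simp add: damp_def fun_eq_iff algebra_simps)
  then have "pi_bond {x, y} (damping \<rho> p (\<lambda>_. 1) W u) =
    (\<lambda>\<eta>. pi_bond {x, y} (damping \<rho> (p(y := p x)) (\<lambda>_. 1) W u) \<eta>
      + (p y - p x) * pi_bond {x, y} (damping \<rho> (p(y := 1)) ((\<lambda>_. 1)(y := 0)) W u) \<eta>)"
    by (simp add: pi_bond_def fun_eq_iff algebra_simps)
  then show ?thesis
    using damping_pi_bond[OF W(1-4), of "p(y := p x)" "\<lambda>_. 1" \<rho> u] W(4) by simp
qed

lemma ip_pi_bond_le:
  assumes g: "local_fn g" and "x \<noteq> y"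
  shows "ip (pi_bond {x, y} g) (pi_bond {x, y} g) \<le> 4 * ip g g"
proof -
  let ?h = "\<lambda>\<eta>. g (exchange {x, y} \<eta>)"
  have l: "local_fn ?h" using assms by blast
  have *: "(s - t) * (s - t) \<le> 2 * (s * s) + 2 * (t * t)" for s t :: real
    using sum_squares_ge_zero[of "s + t" 0] by (simp add: algebra_simps)
  have "ip (pi_bond {x, y} g) (pi_bond {x, y} g)
      \<le> (\<integral>\<eta>. 2 * (?h \<eta> * ?h \<eta>) + 2 * (g \<eta> * g \<eta>) \<partial>bernoulli_measure \<rho>)"
    unfolding ip_def using g l assms
    by (intro integral_mono local_integrable local_fn_arith local_fn_const local_fn_pi_bond)
       (simp_all add: pi_bond_def *)
  also have "\<dots> = 2 * ip ?h ?h + 2 * ip g g"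
    unfolding ip_def using g l
    by (subst Bochner_Integration.integral_add) (auto intro!: local_integrable local_fn_arith local_fn_const)
  also have "ip ?h ?h = ip g g" using g assms by (intro ip_exchange)
  finally show ?thesis by simp
qed

lemma ip_Young:
  assumes f: "local_fn f" and g: "local_fn g" and k: "local_fn k" and K: "\<And>\<eta>. \<bar>k \<eta>\<bar> \<le> K"
  shows "- ip (\<lambda>\<eta>. k \<eta> * f \<eta>) g \<le> (K\<^sup>2 * ip f f + ip g g) / 2"
proof -
  have *: "- (k \<eta> * f \<eta> * g \<eta>) \<le> (K\<^sup>2 * (f \<eta> * f \<eta>) + g \<eta> * g \<eta>) / 2" for \<eta>
  proof -
    have "(k \<eta>)\<^sup>2 \<le> K\<^sup>2" using K[of \<eta>] by (meson abs_ge_zero abs_le_square_iff order_trans abs_ge_self)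
    then have "(k \<eta>)\<^sup>2 * (f \<eta> * f \<eta>) \<le> K\<^sup>2 * (f \<eta> * f \<eta>)" by (intro mult_right_mono) auto
    moreover have "0 \<le> (k \<eta> * f \<eta> + g \<eta>)\<^sup>2" by simp
    ultimately show ?thesis by (simp add: power2_eq_square algebra_simps)
  qed
  have "- ip (\<lambda>\<eta>. k \<eta> * f \<eta>) g = (\<integral>\<eta>. - (k \<eta> * f \<eta> * g \<eta>) \<partial>bernoulli_measure \<rho>)"
    by (simp add: ip_def)
  also have "\<dots> \<le> (\<integral>\<eta>. (K\<^sup>2 / 2) * (f \<eta> * f \<eta>) + (1 / 2) * (g \<eta> * g \<eta>) \<partial>bernoulli_measure \<rho>)"
  proof (rule integral_mono)
    show "integrable (bernoulli_measure \<rho>) (\<lambda>\<eta>. - (k \<eta> * f \<eta> * g \<eta>))"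
      using f g k by (intro local_integrable local_fn_unary(1) local_fn_arith)
    show "integrable (bernoulli_measure \<rho>) (\<lambda>\<eta>. (K\<^sup>2 / 2) * (f \<eta> * f \<eta>) + (1 / 2) * (g \<eta> * g \<eta>))"
      using f g by (intro local_integrable local_fn_arith local_fn_const)
    show "- (k \<eta> * f \<eta> * g \<eta>) \<le> (K\<^sup>2 / 2) * (f \<eta> * f \<eta>) + (1 / 2) * (g \<eta> * g \<eta>)" for \<eta>
      using *[of \<eta>] by (simp add: field_simps)
  qed
  also have "\<dots> = (K\<^sup>2 / 2) * ip f f + (1 / 2) * ip g g"
    unfolding ip_def using f g
    by (subst Bochner_Integration.integral_add) (intro local_integrable local_fn_arith local_fn_const | simp)+
  finally show ?thesis by (simp add: field_simps)
qed

end

section \<open>One step of the Caccioppoli iteration\<close>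

locale exclusion = bernoulli_density +
  fixes c :: "'d::finite site set \<Rightarrow> 'd config \<Rightarrow> real" and r :: nat and lam :: real
  assumes rates: "admissible_rates r lam c" and r_pos: "0 < r"
begin

definition bform :: "'d site set \<Rightarrow> ('d config \<Rightarrow> real) \<Rightarrow> ('d config \<Rightarrow> real) \<Rightarrow> real" where
  "bform b v w = ip (\<lambda>\<eta>. c b \<eta> * pi_bond b v \<eta>) (pi_bond b w)"

text \<open>Twice the Dirichlet form: \<open>energy\<close> carries the factor 1/2, see
  \<open>energy_eq_qform\<close>.\<close>

definition qform :: "nat \<Rightarrow> ('d config \<Rightarrow> real) \<Rightarrow> ('d config \<Rightarrow> real) \<Rightarrow> real" where
  "qform m v w = (\<Sum>b\<in>closed_bonds (lattice_box m). bform b v w)"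

text \<open>The box of radius \<open>m - 1\<close> lies in the lattice interior of the box of radius
  \<open>m\<close> for positive \<open>m\<close>, so these test functions are admissible in
  \<open>harmonic\<close>.\<close>

definition harmonic_box :: "nat \<Rightarrow> ('d config \<Rightarrow> real) \<Rightarrow> bool" where
  "harmonic_box m u \<longleftrightarrow> (\<forall>v. depends_only_on (lattice_box (m - 1)) v \<longrightarrow> qform m v u = 0)"

text \<open>On functions of \<open>W\<close> this is a pointwise version of the conditional
  expectation given the sites of \<open>V\<close>, see
  \<open>site_cond_exp_eq_avg_on\<close>.\<close>

definition avg_on :: "'d site set \<Rightarrow> 'd site set \<Rightarrow> ('d config \<Rightarrow> real) \<Rightarrow> 'd config \<Rightarrow> real" where
  "avg_on W V = damping \<rho> (\<lambda>x. if x \<in> V then 1 else 0) (\<lambda>_. 1) W"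

lemma
  assumes "site_norm (x - y) = 1"
  shows rate_ge: "1 \<le> c {x, y} \<eta>" and rate_le: "c {x, y} \<eta> \<le> lam"
    and rate_exchange: "x \<noteq> y \<Longrightarrow> c {x, y} (exchange {x, y} \<eta>) = c {x, y} \<eta>"
    and rate_box: "depends_only_on (lattice_box (sup_norm x + r)) (c {x, y})"
    and rate_local: "local_fn (c {x, y})"
proof -
  have A: "depends_only_on {z. site_norm (z - x) \<le> real r} (c {x, y})"
    and B: "depends_only_on (- {x, y}) (c {x, y})"
    and C: "\<And>\<eta>. 1 \<le> c {x, y} \<eta> \<and> c {x, y} \<eta> \<le> lam"
    using rates assms unfolding admissible_rates_def by blast+
  show "1 \<le> c {x, y} \<eta>" "c {x, y} \<eta> \<le> lam" using C by auto
  show "c {x, y} (exchange {x, y} \<eta>) = c {x, y} \<eta>"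
    by (rule depends_only_onD[OF B]) (simp add: exchange_def)
  show D: "depends_only_on (lattice_box (sup_norm x + r)) (c {x, y})"
    by (rule depends_only_on_mono[OF A]) (auto simp: lattice_box_def intro: sup_norm_le_site_norm)
  show "local_fn (c {x, y})" by (rule local_fnI[OF _ D]) simp
qed

lemma lam_ge: "1 \<le> lam"
  using rate_ge[of 0 "0 + axis undefined 1"] rate_le[of 0 "0 + axis undefined 1"]
    axis_neighbour(1)[of 0 undefined] by (meson order_trans)

lemma avg_on_local [intro]: "finite W \<Longrightarrow> local_fn f \<Longrightarrow> local_fn (avg_on W V f)"
  unfolding avg_on_def by blast

lemma depends_only_on_avg_on:
  assumes "finite W" "depends_only_on W f" shows "depends_only_on (W \<inter> V) (avg_on W V f)"
  unfolding avg_on_def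
  by (rule depends_only_on_mono[OF depends_only_on_damping[OF assms]]) auto

lemma avg_on_pi_bond:
  assumes "finite W" "x \<in> W" "y \<in> W" "x \<noteq> y" "x \<in> V" "y \<in> V"
  shows "avg_on W V (pi_bond {x, y} f) = pi_bond {x, y} (avg_on W V f)"
  unfolding avg_on_def using assms by (intro damping_pi_bond) auto

lemma avg_on_avg_on:
  assumes "finite W" "V \<subseteq> V'" shows "avg_on W V (avg_on W V' f) = avg_on W V f"
  unfolding avg_on_def damping_damping[OF assms(1)] using assms by (intro damping_cong) auto

lemma avg_on_fixed:
  assumes "finite W" "depends_only_on V f" shows "avg_on W V f = f"
  unfolding avg_on_def using assms(1)
proof (induction W rule: finite_induct)
  case (insert x W)
  have "damp \<rho> 0 1 x f = f" if "x \<notin> V"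
  proof -
    have "f (\<eta>(x := v)) = f \<eta>" for \<eta> v
      by (rule depends_only_onD[OF assms(2)]) (use that in auto)
    then show ?thesis by (simp add: damp_def site_avg_def fun_eq_iff algebra_simps)
  qed
  with insert show ?case by (simp add: damping_insert)
qed simp

lemma ip_avg_on:
  assumes "finite W" "local_fn f" "local_fn g"
  shows "ip (avg_on W V f) g = ip f (avg_on W V g)"
  unfolding avg_on_def using assms by (rule ip_damping)

lemma ip_avg_on_le:
  assumes "finite W" "local_fn f" shows "ip (avg_on W V f) (avg_on W V f) \<le> ip f f"
  unfolding avg_on_def using assms by (intro damping_contraction) auto

text \<open>Both operators are trivial on the sites that \<open>k\<close> depends on, so
  \<open>sqrt k\<close> can be attached to both factors and commuted inside. What remains is a
  comparison of eigenvalues: the indicator of \<open>V\<close> is at most \<open>p\<close> on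
  \<open>W\<close>.\<close>

lemma weighted_avg_le_damping:
  assumes W: "finite W" and f: "local_fn f" and k: "depends_only_on V k" "local_fn k" "\<And>\<eta>. 0 \<le> k \<eta>"
    and p: "\<And>x. x \<in> W \<Longrightarrow> 0 \<le> p x" "\<And>x. x \<in> V \<Longrightarrow> p x = 1"
  shows "ip (\<lambda>\<eta>. k \<eta> * avg_on W V f \<eta>) (avg_on W V f) \<le> ip (\<lambda>\<eta>. k \<eta> * damping \<rho> p (\<lambda>_. 1) W f \<eta>) f"
proof -
  let ?s = "\<lambda>\<eta>. sqrt (k \<eta>)"
  let ?f = "\<lambda>\<eta>. ?s \<eta> * f \<eta>"
  have ds: "depends_only_on V ?s" using k(1) by (rule depends_only_on_compose)
  have lf: "local_fn ?f" using k f by (intro local_fn_arith local_fn_unary)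
  have split: "ip (\<lambda>\<eta>. k \<eta> * v \<eta>) w = ip (\<lambda>\<eta>. ?s \<eta> * v \<eta>) (\<lambda>\<eta>. ?s \<eta> * w \<eta>)" for v w
  proof -
    have "k \<eta> * v \<eta> * w \<eta> = (?s \<eta> * v \<eta>) * (?s \<eta> * w \<eta>)" for \<eta>
    proof -
      have "(?s \<eta> * v \<eta>) * (?s \<eta> * w \<eta>) = (?s \<eta> * ?s \<eta>) * v \<eta> * w \<eta>" by (simp only: mult_ac)
      then show ?thesis using k(3)[of \<eta>] by simp
    qed
    then show ?thesis unfolding ip_def by presburger
  qed
  have "ip (\<lambda>\<eta>. k \<eta> * avg_on W V f \<eta>) (avg_on W V f) = ip (avg_on W V ?f) (avg_on W V ?f)"
    unfolding split avg_on_def using W ds by (subst (1 2) damping_mult) auto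
  also have "\<dots> = ip (avg_on W V ?f) ?f"
    using W lf by (simp add: ip_avg_on[symmetric] avg_on_local avg_on_avg_on)
  also have "\<dots> \<le> ip (damping \<rho> p (\<lambda>_. 1) W ?f) ?f"
    unfolding avg_on_def using W lf p by (intro spectral_mono) auto
  also have "\<dots> = ip (\<lambda>\<eta>. k \<eta> * damping \<rho> p (\<lambda>_. 1) W f \<eta>) f"
    unfolding split using W ds p by (subst damping_mult) auto
  finally show ?thesis .
qed

section \<open>Dirichlet forms and harmonicity under local averages\<close>

lemma bform_bounds:
  assumes b: "b \<in> closed_bonds (lattice_box m)" and u: "local_fn u"
  shows "ip (pi_bond b u) (pi_bond b u) \<le> bform b u u" "0 \<le> bform b u u"
proof -
  obtain x y where xy: "b = {x, y}" "x \<noteq> y" "site_norm (x - y) = 1" using b by (rule closed_bondsE)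
  have l: "local_fn (pi_bond b u)" "local_fn (c b)" using u xy rate_local by auto
  have *: "1 \<le> c b \<eta>" for \<eta> using rate_ge xy by auto
  show "ip (pi_bond b u) (pi_bond b u) \<le> bform b u u"
    unfolding bform_def using l * mult_right_mono[of 1 "c b _" "pi_bond b u _ * pi_bond b u _"]
    by (intro ip_mono local_fn_arith) (auto simp: mult.assoc)
  then show "0 \<le> bform b u u" using ip_self_nonneg[of "pi_bond b u"] by linarith
qed

text \<open>Jensen's inequality, obtained from \<open>weighted_avg_le_damping\<close> with
  \<open>p = 1\<close>. The radius \<open>n + r\<close> covers all sites on which the rates of the
  bonds of the box depend.\<close>

lemma bform_avg_on_le:
  assumes b: "b \<in> closed_bonds (lattice_box n)" and u: "local_fn u" and W: "finite W" "lattice_box (n + r) \<subseteq> W"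
  shows "bform b (avg_on W (lattice_box (n + r)) u) (avg_on W (lattice_box (n + r)) u) \<le> bform b u u"
proof -
  obtain x y where xy: "b = {x, y}" "x \<noteq> y" "site_norm (x - y) = 1" "sup_norm x \<le> n"
      "sup_norm y \<le> sup_norm x + 1" using b by (rule closed_bondsE)
  let ?V = "lattice_box (n + r)"
  have V: "x \<in> ?V" "y \<in> ?V" using xy r_pos by (auto simp: lattice_box_def)
  have l: "local_fn (pi_bond {x, y} u)" using u xy by auto
  have d: "depends_only_on ?V (c {x, y})"
    using rate_box[OF xy(3)] by (rule depends_only_on_mono) (use xy in \<open>auto simp: lattice_box_def\<close>)
  have "ip (\<lambda>\<eta>. c {x, y} \<eta> * avg_on W ?V (pi_bond {x, y} u) \<eta>) (avg_on W ?V (pi_bond {x, y} u))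
      \<le> ip (\<lambda>\<eta>. c {x, y} \<eta> * damping \<rho> (\<lambda>_. 1) (\<lambda>_. 1) W (pi_bond {x, y} u) \<eta>) (pi_bond {x, y} u)"
    using W l d rate_local[OF xy(3)] order_trans[OF zero_le_one rate_ge[OF xy(3)]]
    by (intro weighted_avg_le_damping) auto
  moreover have "avg_on W ?V (pi_bond {x, y} u) = pi_bond {x, y} (avg_on W ?V u)"
    using W V xy by (intro avg_on_pi_bond) auto
  ultimately show ?thesis
    unfolding bform_def xy(1) using W by (simp add: damping_id)
qed

text \<open>On bonds of the smaller box, \<open>c b\<close> times the gradient of the test function
  depends only on the sites kept by the average. By self-adjointness the average moves to this
  factor and leaves it unchanged. This makes the Caccioppoli step repeatable.\<close>

lemma harmonic_box_avg_on:
  assumes h: "harmonic_box m u" and u: "local_fn u" and n: "0 < n" "n \<le> m"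
    and W: "finite W" "lattice_box (n + r) \<subseteq> W"
  shows "harmonic_box n (avg_on W (lattice_box (n + r)) u)"
  unfolding harmonic_box_def
proof (intro allI impI)
  fix v :: "'d config \<Rightarrow> real" assume v: "depends_only_on (lattice_box (n - 1)) v"
  let ?V = "lattice_box (n + r)"
  have lv: "local_fn v" using v by (intro local_fnI) auto
  have "qform n v (avg_on W ?V u) = qform n v u"
    unfolding qform_def
  proof (rule sum.cong[OF refl])
    fix b :: "'d site set" assume b: "b \<in> closed_bonds (lattice_box n)"
    obtain x y where xy: "b = {x, y}" "x \<noteq> y" "site_norm (x - y) = 1" "sup_norm x \<le> n"
      "sup_norm y \<le> sup_norm x + 1" using b by (rule closed_bondsE)
    have V: "x \<in> ?V" "y \<in> ?V" using xy r_pos by (auto simp: lattice_box_def)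
    have d: "depends_only_on ?V (c b)"
      unfolding xy(1) using rate_box[OF xy(3)] by (rule depends_only_on_mono) (use xy in \<open>auto simp: lattice_box_def\<close>)
    have "depends_only_on ?V (pi_bond b v)"
      unfolding xy(1) using V xy(2) depends_only_on_mono[OF v lattice_box_mono[of "n - 1" "n + r"]]
      by (intro depends_only_on_pi_bond) auto
    from depends_only_on_compose2[OF d this, of "(*)"]
    have dv: "depends_only_on ?V (\<lambda>\<eta>. c b \<eta> * pi_bond b v \<eta>)" .
    have "bform b v (avg_on W ?V u) = ip (\<lambda>\<eta>. c b \<eta> * pi_bond b v \<eta>) (avg_on W ?V (pi_bond b u))"
      unfolding bform_def xy(1) using W V xy by (subst avg_on_pi_bond) auto
    also have "\<dots> = ip (avg_on W ?V (\<lambda>\<eta>. c b \<eta> * pi_bond b v \<eta>)) (pi_bond b u)"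
    proof (rule ip_avg_on[symmetric, OF W(1)])
      show "local_fn (\<lambda>\<eta>. c b \<eta> * pi_bond b v \<eta>)" by (rule local_fnI[OF _ dv]) simp
      show "local_fn (pi_bond b u)" unfolding xy(1) using u xy(2) by blast
    qed
    also have "\<dots> = bform b v u"
      unfolding bform_def using W dv by (simp add: avg_on_fixed)
    finally show "bform b v (avg_on W ?V u) = bform b v u" .
  qed
  also have "\<dots> = qform m v u"
    unfolding qform_def
  proof (rule sum.mono_neutral_left)
    show "\<forall>b\<in>closed_bonds (lattice_box m) - closed_bonds (lattice_box n). bform b v u = 0"
    proof
      fix b :: "'d site set" assume b: "b \<in> closed_bonds (lattice_box m) - closed_bonds (lattice_box n)"
      then obtain x i where xi: "b = {x, x + axis i 1}" "sup_norm x > n"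
        unfolding closed_bonds_def lattice_box_def by fastforce
      \<comment> \<open>As \<open>x\<close> has norm above \<open>n\<close>, its neighbour has norm
        at least \<open>n\<close>; both miss the box of radius \<open>n - 1\<close>, because
        \<open>n\<close> is positive.\<close>
      have "pi_bond b v = (\<lambda>\<eta>. 0)"
        unfolding xi(1) using xi(2) axis_neighbour[where x = x and i = i] n(1)
        by (intro pi_bond_eq_0[OF v]) (auto simp: lattice_box_def)
      then show "bform b v u = 0" by (simp add: bform_def ip_def)
    qed
  qed (use closed_bonds_mono n in auto)
  also have "\<dots> = 0"
    using h v depends_only_on_mono[OF v lattice_box_mono[of "n - 1" "m - 1"]] n unfolding harmonic_box_def by auto
  finally show "qform n v (avg_on W ?V u) = 0" .
qed

end

context exclusion
begin

text \<open>By \<open>damping_split\<close> the form is a diagonal term plus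
  \<open>p y - p x\<close> times an influence. Young's inequality trades the latter for half the
  local energy and, through the factor 4 of \<open>ip_pi_bond_le\<close>, for
  \<open>2 * lam\<^sup>2 * \<kappa>\<close> times \<open>G y\<close>. The profile \<open>q\<close>
  depends on the bond; only its range and the preservation of the value 1 are used
  afterwards.\<close>

lemma bform_damping_ge:
  assumes b: "b \<in> closed_bonds (lattice_box m)" and u: "local_fn u"
    and W: "finite W" "lattice_box (Suc m) \<subseteq> W"
    and p: "\<And>x. 0 \<le> p x \<and> p x \<le> 1"
    and slope: "\<And>x y. site_norm (x - y) = 1 \<Longrightarrow> p y \<le> p x \<Longrightarrow> (p x - p y)\<^sup>2 \<le> \<kappa> * (1 - p y)"
  defines "G \<equiv> \<lambda>z. (1 - p z) * ip (damping \<rho> (p(z := 1)) ((\<lambda>_. 1)(z := 0)) W u)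
                          (damping \<rho> (p(z := 1)) ((\<lambda>_. 1)(z := 0)) W u)"
  shows "\<exists>q. (\<forall>x. 0 \<le> q x \<and> q x \<le> 1) \<and> (\<forall>x. p x = 1 \<longrightarrow> q x = 1) \<and>
    ip (\<lambda>\<eta>. c b \<eta> * damping \<rho> q (\<lambda>_. 1) W (pi_bond b u) \<eta>) (pi_bond b u)
      - ip (pi_bond b u) (pi_bond b u) / 2 - 2 * lam\<^sup>2 * \<kappa> * (\<Sum>z\<in>b. G z)
    \<le> bform b (damping \<rho> p (\<lambda>_. 1) W u) u"
proof -
  obtain x' y' where b': "b = {x', y'}" "x' \<noteq> y'" "site_norm (x' - y') = 1" "sup_norm x' \<le> m"
    "sup_norm y' \<le> sup_norm x' + 1" using b by (rule closed_bondsE)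
  have W': "x' \<in> W" "y' \<in> W" using W b' by (auto simp: lattice_box_def)
  \<comment> \<open>The endpoint with the smaller \<open>p\<close> is called \<open>y\<close>, since
    \<open>slope\<close> bounds the jump by \<open>1 - p y\<close> and the influence must be taken
    at the same site.\<close>
  obtain x y where xy: "b = {x, y}" "x \<noteq> y" "site_norm (x - y) = 1" "x \<in> W" "y \<in> W" "p y \<le> p x"
  proof (cases "p y' \<le> p x'")
    case True
    then show ?thesis using that b' W' by blast
  next
    case False
    then show ?thesis using that[of y' x'] b' W' site_norm_minus[of x' y'] by (simp add: insert_commute)
  qed
  define g where "g = damping \<rho> (p(y := 1)) ((\<lambda>_. 1)(y := 0)) W u"
  define q where "q = p(y := p x)"
  let ?\<pi> = "pi_bond {x, y}"
  let ?T = "damping \<rho> q (\<lambda>_. 1) W (?\<pi> u)"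
  let ?\<delta> = "p y - p x"
  have loc: "local_fn g" "local_fn (?\<pi> u)" "local_fn (?\<pi> g)" "local_fn (c {x, y})" "local_fn ?T"
    using u W xy rate_local unfolding g_def by (auto intro!: damping_local)
  have G0: "0 \<le> G z" for z unfolding G_def using p by (intro mult_nonneg_nonneg ip_self_nonneg) simp
  have lc: "local_fn (\<lambda>\<eta>. ?\<delta> * c {x, y} \<eta>)" using loc by (intro local_fn_arith local_fn_const)
  have "bform b (damping \<rho> p (\<lambda>_. 1) W u) u
      = ip (\<lambda>\<eta>. c {x, y} \<eta> * (?T \<eta> + ?\<delta> * ?\<pi> g \<eta>)) (?\<pi> u)"
    unfolding bform_def xy(1) damping_split[OF W(1) xy(4,5,2)] g_def q_def ..
  also have "\<dots> = ip (\<lambda>\<eta>. c {x, y} \<eta> * ?T \<eta> + ?\<delta> * c {x, y} \<eta> * ?\<pi> g \<eta>) (?\<pi> u)"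
    by (simp add: algebra_simps)
  also have "\<dots> = ip (\<lambda>\<eta>. c {x, y} \<eta> * ?T \<eta>) (?\<pi> u) + ip (\<lambda>\<eta>. ?\<delta> * c {x, y} \<eta> * ?\<pi> g \<eta>) (?\<pi> u)"
    using loc lc local_fn_arith(3)[OF loc(4,5)] local_fn_arith(3)[OF lc loc(3)] by (intro ip_add_left) auto
  finally have eq: "bform b (damping \<rho> p (\<lambda>_. 1) W u) u
      = ip (\<lambda>\<eta>. c {x, y} \<eta> * ?T \<eta>) (?\<pi> u) + ip (\<lambda>\<eta>. ?\<delta> * c {x, y} \<eta> * ?\<pi> g \<eta>) (?\<pi> u)" .
  have Young: "- ip (\<lambda>\<eta>. ?\<delta> * c {x, y} \<eta> * ?\<pi> g \<eta>) (?\<pi> u)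
      \<le> ((\<bar>?\<delta>\<bar> * lam)\<^sup>2 * ip (?\<pi> g) (?\<pi> g) + ip (?\<pi> u) (?\<pi> u)) / 2"
  proof (rule ip_Young[OF loc(3,2) lc])
    fix \<eta>
    show "\<bar>?\<delta> * c {x, y} \<eta>\<bar> \<le> \<bar>?\<delta>\<bar> * lam"
      using rate_ge[OF xy(3), of \<eta>] rate_le[OF xy(3), of \<eta>] by (simp add: abs_mult mult_left_mono)
  qed
  have influence: "(\<bar>?\<delta>\<bar> * lam)\<^sup>2 * ip (?\<pi> g) (?\<pi> g) \<le> 4 * lam\<^sup>2 * \<kappa> * (\<Sum>z\<in>b. G z)"
  proof -
    have "(\<bar>?\<delta>\<bar> * lam)\<^sup>2 * ip (?\<pi> g) (?\<pi> g) \<le> (\<bar>?\<delta>\<bar> * lam)\<^sup>2 * (4 * ip g g)"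
      using loc xy by (intro mult_left_mono ip_pi_bond_le) auto
    also have "\<dots> = 4 * lam\<^sup>2 * ((p x - p y)\<^sup>2 * ip g g)"
      by (simp add: power_mult_distrib power2_commute)
    also have "\<dots> \<le> 4 * lam\<^sup>2 * ((\<kappa> * (1 - p y)) * ip g g)"
      using slope[OF xy(3,6)] by (intro mult_left_mono mult_right_mono ip_self_nonneg) auto
    also have "\<dots> = 4 * lam\<^sup>2 * (\<kappa> * G y)" unfolding G_def g_def by simp
    also have "\<dots> \<le> 4 * lam\<^sup>2 * (\<kappa> * (\<Sum>z\<in>b. G z))"
    proof -
      have "\<kappa> * G y \<le> \<kappa> * (\<Sum>z\<in>b. G z)"
      \<comment> \<open>If \<open>p y = 1\<close>, then also \<open>p x = 1\<close> and both weights
        vanish; otherwise \<open>slope\<close> forces \<kappa> to be nonnegative.\<close>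
      proof (cases "p y = 1")
        case True
        then have "p x = 1" using p[of x] xy(6) by simp
        show ?thesis
          using \<open>p x = 1\<close> True xy by (simp add: G_def)
      next
        case False
        then have "0 < 1 - p y" using p[of y] by simp
        moreover have "0 \<le> \<kappa> * (1 - p y)" using slope[OF xy(3,6)] by (meson order_trans zero_le_power2)
        ultimately have "0 \<le> \<kappa>" by (simp add: zero_le_mult_iff)
        then show ?thesis using xy G0[of x] by (intro mult_left_mono) auto
      qed
      from mult_left_mono[OF this, of "4 * lam\<^sup>2"] show ?thesis by simp
    qed
    finally show ?thesis by (simp add: mult.assoc)
  qed
  have "ip (\<lambda>\<eta>. c b \<eta> * ?T \<eta>) (pi_bond b u) - ip (pi_bond b u) (pi_bond b u) / 2
      - 2 * lam\<^sup>2 * \<kappa> * (\<Sum>z\<in>b. G z) \<le> bform b (damping \<rho> p (\<lambda>_. 1) W u) u"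
  proof -
    have "2 * lam\<^sup>2 * \<kappa> * (\<Sum>z\<in>b. G z) = (4 * lam\<^sup>2 * \<kappa> * (\<Sum>z\<in>b. G z)) / 2" by simp
    with Young influence show ?thesis unfolding eq unfolding xy(1) by argo
  qed
  moreover have "\<forall>z. 0 \<le> q z \<and> q z \<le> 1" using p by (simp add: q_def)
  moreover have "\<forall>z. p z = 1 \<longrightarrow> q z = 1" using p[of x] xy(6) by (auto simp: q_def)
  ultimately show ?thesis unfolding xy(1) by blast
qed

text \<open>The equation is tested with the damped function. Inner bonds contribute at least the
  energy of \<open>A\<close>, the other bonds at least \<open>- lam\<close> times the energy of
  \<open>u\<close>, and every bond loses half its energy to Young's inequality.\<close>

lemma caccioppoli_step:
  assumes W: "finite W" "lattice_box (Suc m) \<subseteq> W" and u: "depends_only_on W u"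
    and harm: "harmonic_box m u" and h: "0 < h" and n: "n + r + h \<le> m"
  defines "A \<equiv> avg_on W (lattice_box (n + r)) u"
  shows "qform n A A \<le> (lam + 1 / 2) / (lam + 1) * qform m u u
    + 16 * real CARD('d) * lam\<^sup>2 / (real h)\<^sup>2 * ip u u"
proof -
  have lu: "local_fn u" using W(1) u by (rule local_fnI)
  \<comment> \<open>Truncated subtraction makes \<open>t\<close> vanish up to radius
    \<open>n + r\<close>; it reaches 1 at radius \<open>n + r + h\<close>, which is at most
    \<open>m\<close>. Hence the test function depends only on the box of radius
    \<open>m - 1\<close>.\<close>
  define t where "t z = real (min h (sup_norm z - (n + r))) / real h" for z :: "'d site"
  define p where "p z = 1 - (t z)\<^sup>2" for z
  define G where "G z = (1 - p z) * ip (damping \<rho> (p(z := 1)) ((\<lambda>_. 1)(z := 0)) W u)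
                          (damping \<rho> (p(z := 1)) ((\<lambda>_. 1)(z := 0)) W u)" for z
  define \<kappa> where "\<kappa> = 4 / (real h)\<^sup>2"
  have t: "0 \<le> t z" "t z \<le> 1" for z using h by (auto simp: t_def)
  have p01: "0 \<le> p z \<and> p z \<le> 1" for z
    using t[of z] by (simp add: p_def power_le_one)
  have p1: "p z = 1" if "sup_norm z \<le> n + r" for z using that by (simp add: p_def t_def)
  have p0: "p z = 0" if "m \<le> sup_norm z" for z using that n h by (simp add: p_def t_def min_absorb1)
  have slope: "(p x - p y)\<^sup>2 \<le> \<kappa> * (1 - p y)" if xy: "site_norm (x - y) = 1" "p y \<le> p x" for x y
  proof -
    have "sup_norm x \<le> sup_norm y + 1" "sup_norm y \<le> sup_norm x + 1"
      using xy site_norm_minus[of x y] sup_norm_le_site_norm[of x y 1] sup_norm_le_site_norm[of y x 1] by simp_all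
    then have "real (min h (sup_norm y - (n + r))) \<le> real (min h (sup_norm x - (n + r))) + 1" by simp
    then have d: "t y - t x \<le> 1 / real h"
      unfolding t_def diff_divide_distrib[symmetric] by (intro divide_right_mono) auto
    have "(t x)\<^sup>2 \<le> (t y)\<^sup>2" using xy by (simp add: p_def)
    then have le: "t x \<le> t y" using t by (rule_tac power2_le_imp_le) auto
    \<comment> \<open>The factor \<open>t y + t x\<close> is at most \<open>2 * t y\<close>, and
      \<open>(t y)\<^sup>2\<close> is \<open>1 - p y\<close>; this is where the quadratic profile
      pays off and where the 4 in \<kappa> arises.\<close>
    have "p x - p y = (t y - t x) * (t y + t x)" by (simp add: p_def power2_eq_square algebra_simps)
    also have "\<dots> \<le> (1 / real h) * (2 * t y)" using d le t[of x] t[of y] by (intro mult_mono) auto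
    finally have "(p x - p y)\<^sup>2 \<le> ((1 / real h) * (2 * t y))\<^sup>2" using xy by (intro power_mono) auto
    then show ?thesis by (simp add: \<kappa>_def p_def power2_eq_square)
  qed
  define T where "T = damping \<rho> p (\<lambda>_. 1) W u"
  have dT: "depends_only_on (lattice_box (m - 1)) T"
    unfolding T_def
  proof (rule depends_only_on_mono[OF depends_only_on_damping[OF W(1) u]])
    show "W - {x \<in> W. p x = 0} \<subseteq> lattice_box (m - 1)"
      using p0 by (force simp: lattice_box_def)
  qed
  have G0: "0 \<le> G z" for z unfolding G_def using p01 by (intro mult_nonneg_nonneg ip_self_nonneg) simp
  let ?E = "\<lambda>b. bform b u u / 2 + 2 * lam\<^sup>2 * \<kappa> * (\<Sum>z\<in>b. G z)"
  \<comment> \<open>The rate of an inner bond sees only the box of radius \<open>n + r\<close>,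
    where \<open>p\<close>, and hence \<open>q\<close>, equals 1; so the diagonal term dominates the
    form of the average.\<close>
  have inner: "bform b A A - ?E b \<le> bform b T u" if b: "b \<in> closed_bonds (lattice_box n)" for b
  proof -
    have bm: "b \<in> closed_bonds (lattice_box m)" using b closed_bonds_mono[of n m] n by auto
    obtain q where q: "\<forall>x. 0 \<le> q x \<and> q x \<le> 1" "\<forall>x. p x = 1 \<longrightarrow> q x = 1"
      and le: "ip (\<lambda>\<eta>. c b \<eta> * damping \<rho> q (\<lambda>_. 1) W (pi_bond b u) \<eta>) (pi_bond b u)
      - ip (pi_bond b u) (pi_bond b u) / 2 - 2 * lam\<^sup>2 * \<kappa> * (\<Sum>z\<in>b. G z) \<le> bform b T u"
      using bform_damping_ge[where p = p, OF bm lu W p01 slope] unfolding T_def G_def by blast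
    obtain x y where xy: "b = {x, y}" "x \<noteq> y" "site_norm (x - y) = 1" "sup_norm x \<le> n"
      "sup_norm y \<le> sup_norm x + 1" using b by (rule closed_bondsE)
    let ?V = "lattice_box (n + r)"
    have V: "x \<in> ?V" "y \<in> ?V" using xy r_pos by (auto simp: lattice_box_def)
    have VW: "?V \<subseteq> W" using W(2) lattice_box_mono[of "n + r" "Suc m"] n by auto
    have d: "depends_only_on ?V (c b)"
      unfolding xy(1) using rate_box[OF xy(3)] by (rule depends_only_on_mono) (use xy in \<open>auto simp: lattice_box_def\<close>)
    have pA: "avg_on W ?V (pi_bond b u) = pi_bond b A"
      unfolding A_def xy(1) using W V VW xy by (intro avg_on_pi_bond) auto
    have "bform b A A = ip (\<lambda>\<eta>. c b \<eta> * avg_on W ?V (pi_bond b u) \<eta>) (avg_on W ?V (pi_bond b u))"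
      unfolding bform_def pA ..
    also have "\<dots> \<le> ip (\<lambda>\<eta>. c b \<eta> * damping \<rho> q (\<lambda>_. 1) W (pi_bond b u) \<eta>) (pi_bond b u)"
    proof (rule weighted_avg_le_damping[OF W(1) _ d])
      show "local_fn (pi_bond b u)" "local_fn (c b)" unfolding xy(1) using lu xy rate_local by auto
      show "0 \<le> c b \<eta>" for \<eta> unfolding xy(1) using rate_ge[OF xy(3), of \<eta>] by simp
    qed (use q p1 in \<open>auto simp: lattice_box_def\<close>)
    finally show ?thesis using le bform_bounds(1)[OF b lu] by linarith
  qed
  \<comment> \<open>Here resampling may change the rate, so the diagonal term has no sign; only the
    contraction property and the bound \<open>lam\<close> on the rate are used.\<close>
  have outer: "- lam * bform b u u - ?E b \<le> bform b T u" if b: "b \<in> closed_bonds (lattice_box m)" for b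
  proof -
    obtain q where q: "\<forall>x. 0 \<le> q x \<and> q x \<le> 1" "\<forall>x. p x = 1 \<longrightarrow> q x = 1"
      and le: "ip (\<lambda>\<eta>. c b \<eta> * damping \<rho> q (\<lambda>_. 1) W (pi_bond b u) \<eta>) (pi_bond b u)
      - ip (pi_bond b u) (pi_bond b u) / 2 - 2 * lam\<^sup>2 * \<kappa> * (\<Sum>z\<in>b. G z) \<le> bform b T u"
      using bform_damping_ge[where p = p, OF b lu W p01 slope] unfolding T_def G_def by blast
    obtain x y where xy: "b = {x, y}" "x \<noteq> y" "site_norm (x - y) = 1" using b by (rule closed_bondsE)
    have l: "local_fn (pi_bond b u)" "local_fn (c b)" unfolding xy(1) using lu xy rate_local by auto
    let ?f = "damping \<rho> q (\<lambda>_. 1) W (pi_bond b u)"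
    have lf: "local_fn ?f" using W l by blast
    have "- ip (\<lambda>\<eta>. c b \<eta> * ?f \<eta>) (pi_bond b u) \<le> lam * ip (pi_bond b u) (pi_bond b u)"
    proof -
      have "- ip (\<lambda>\<eta>. (c b \<eta> / lam) * ?f \<eta>) (pi_bond b u)
          \<le> (1\<^sup>2 * ip ?f ?f + ip (pi_bond b u) (pi_bond b u)) / 2"
      proof (rule ip_Young[OF lf l(1)])
        show "local_fn (\<lambda>\<eta>. c b \<eta> / lam)" using l(2) by (rule local_fn_compose)
        show "\<bar>c b \<eta> / lam\<bar> \<le> 1" for \<eta>
          unfolding xy(1) using rate_ge[OF xy(3), of \<eta>] rate_le[OF xy(3), of \<eta>] by simp
      qed
      moreover have "ip ?f ?f \<le> ip (pi_bond b u) (pi_bond b u)"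
        using W l q by (intro damping_contraction) auto
      moreover have "ip (\<lambda>\<eta>. c b \<eta> * ?f \<eta>) (pi_bond b u) = lam * ip (\<lambda>\<eta>. (c b \<eta> / lam) * ?f \<eta>) (pi_bond b u)"
        using lam_ge ip_scale_left[of lam "\<lambda>\<eta>. (c b \<eta> / lam) * ?f \<eta>" "pi_bond b u"] by simp
      ultimately have "- ip (\<lambda>\<eta>. (c b \<eta> / lam) * ?f \<eta>) (pi_bond b u) \<le> ip (pi_bond b u) (pi_bond b u)" by simp
      from mult_left_mono[OF this, of lam] show ?thesis
        using lam_ge \<open>ip (\<lambda>\<eta>. c b \<eta> * ?f \<eta>) (pi_bond b u) = _\<close> by simp
    qed
    also have "\<dots> \<le> lam * bform b u u"
      using bform_bounds(1)[OF b lu] lam_ge by (intro mult_left_mono) auto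
    finally show ?thesis using le bform_bounds(1)[OF b lu] by linarith
  qed
  let ?Bn = "closed_bonds (lattice_box n) :: 'd site set set" and ?Bm = "closed_bonds (lattice_box m) :: 'd site set set"
  have sub: "?Bn \<subseteq> ?Bm" using closed_bonds_mono[of n m] n by simp
  have "0 = qform m T u" using harm dT unfolding harmonic_box_def by simp
  also have "\<dots> = (\<Sum>b\<in>?Bn. bform b T u) + (\<Sum>b\<in>?Bm - ?Bn. bform b T u)"
    unfolding qform_def using sum.subset_diff[OF sub] by (simp add: add.commute)
  also have "\<dots> \<ge> (\<Sum>b\<in>?Bn. bform b A A - ?E b) + (\<Sum>b\<in>?Bm - ?Bn. - lam * bform b u u - ?E b)"
    by (intro add_mono sum_mono inner outer) auto
  finally have "(\<Sum>b\<in>?Bn. bform b A A - ?E b) + (\<Sum>b\<in>?Bm - ?Bn. - lam * bform b u u - ?E b) \<le> 0" .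
  moreover have "(\<Sum>b\<in>?Bn. ?E b) + (\<Sum>b\<in>?Bm - ?Bn. ?E b) = (\<Sum>b\<in>?Bm. ?E b)"
    using sum.subset_diff[OF sub, of ?E] by simp
  ultimately have "qform n A A \<le> lam * (\<Sum>b\<in>?Bm - ?Bn. bform b u u) + (\<Sum>b\<in>?Bm. ?E b)"
    unfolding qform_def by (simp only: sum_subtractf sum_negf sum_distrib_left[symmetric])
  also have "(\<Sum>b\<in>?Bm - ?Bn. bform b u u) = qform m u u - qform n u u"
    unfolding qform_def using sum.subset_diff[OF sub, of "\<lambda>b. bform b u u"] by simp
  also have "(\<Sum>b\<in>?Bm. ?E b) = qform m u u / 2 + 2 * lam\<^sup>2 * \<kappa> * (\<Sum>b\<in>?Bm. \<Sum>z\<in>b. G z)"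
    unfolding qform_def sum.distrib sum_divide_distrib sum_distrib_left ..
  finally have 1: "qform n A A \<le> lam * (qform m u u - qform n u u)
      + (qform m u u / 2 + 2 * lam\<^sup>2 * \<kappa> * (\<Sum>b\<in>?Bm. \<Sum>z\<in>b. G z))" .
  \<comment> \<open>Hole filling: the term \<open>- lam * qform n u u\<close> is replaced by
    \<open>- lam * qform n A A\<close> and moved to the left, which yields the ratio of
    \<open>lam + 1 / 2\<close> to \<open>lam + 1\<close>.\<close>
  have "qform n A A \<le> qform n u u"
    unfolding qform_def A_def using lu W lattice_box_mono[of "n + r" "Suc m"] n
    by (intro sum_mono bform_avg_on_le) auto
  then have 2: "lam * qform n A A \<le> lam * qform n u u" using lam_ge by (intro mult_left_mono) auto
  \<comment> \<open>The factor 16 collects 2 from the influence bound, 4 from \<kappa> and 2 from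
    the count of bonds at a site.\<close>
  have "(\<Sum>b\<in>?Bm. \<Sum>z\<in>b. G z) \<le> 2 * real CARD('d) * (\<Sum>z\<in>W. G z)"
    by (rule sum_closed_bonds_le[OF G0 W])
  also have "\<dots> \<le> 2 * real CARD('d) * ip u u"
    unfolding G_def using W lu p01 by (intro mult_left_mono sum_influence_le) auto
  finally have "2 * lam\<^sup>2 * \<kappa> * (\<Sum>b\<in>?Bm. \<Sum>z\<in>b. G z) \<le> 2 * lam\<^sup>2 * \<kappa> * (2 * real CARD('d) * ip u u)"
    by (intro mult_left_mono) (auto simp: \<kappa>_def)
  also have "\<dots> = 16 * real CARD('d) * lam\<^sup>2 / (real h)\<^sup>2 * ip u u" (is "_ = ?R") by (simp add: \<kappa>_def)
  finally have "(lam + 1) * qform n A A \<le> (lam + 1 / 2) * qform m u u + ?R"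
    using 1 2 by (simp add: algebra_simps)
  also have "\<dots> \<le> (lam + 1 / 2) * qform m u u + (lam + 1) * ?R"
    using lam_ge ip_self_nonneg[of u] mult_right_mono[of 1 "lam + 1" ?R] by simp
  finally have "(lam + 1) * qform n A A \<le> (lam + 1) * ((lam + 1 / 2) / (lam + 1) * qform m u u + ?R)"
    using lam_ge by (simp add: distrib_left)
  then show ?thesis using lam_ge by simp
qed

text \<open>A step costs \<open>h\<close> in radius for the layer and \<open>r\<close> for the range
  of the rates. The \<open>L^2\<close> norm does not grow under averaging and the contraction factor
  is at most 1, so the errors simply add up.\<close>

lemma caccioppoli_iterated:
  assumes W: "finite W" and s: "0 < s" and h: "0 < h"
    and "lattice_box (Suc M) \<subseteq> W" "depends_only_on W u" "harmonic_box M u" "s + N * (h + r) \<le> M"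
    and "lattice_box (s + r) \<subseteq> W"
  shows "qform s (avg_on W (lattice_box (s + r)) u) (avg_on W (lattice_box (s + r)) u)
    \<le> ((lam + 1 / 2) / (lam + 1)) ^ N * qform M u u
      + real N * (16 * real CARD('d) * lam\<^sup>2 / (real h)\<^sup>2 * ip u u)"
  using assms(4-)
proof (induction N arbitrary: M u)
  case 0
  have lu: "local_fn u" using W 0(2) by (rule local_fnI)
  have "qform s (avg_on W (lattice_box (s + r)) u) (avg_on W (lattice_box (s + r)) u) \<le> qform s u u"
    unfolding qform_def using lu W 0 by (intro sum_mono bform_avg_on_le) auto
  also have "\<dots> \<le> qform M u u"
    unfolding qform_def using 0 lu closed_bonds_mono[of s M] by (intro sum_mono2 bform_bounds(2)) auto
  finally show ?case by simp
next
  case (Suc N)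
  define n where "n = M - (h + r)"
  have n: "s + N * (h + r) \<le> n" "n + r + h \<le> M" using Suc.prems(4) by (auto simp: n_def)
  define w where "w = avg_on W (lattice_box (n + r)) u"
  let ?\<theta> = "(lam + 1 / 2) / (lam + 1)" and ?K = "16 * real CARD('d) * lam\<^sup>2 / (real h)\<^sup>2"
  have \<theta>: "0 \<le> ?\<theta>" "?\<theta> \<le> 1" using lam_ge by auto
  have lu: "local_fn u" using W Suc.prems(2) by (rule local_fnI)
  have box: "lattice_box (n + r) \<subseteq> W"
    using lattice_box_mono[of "n + r" "Suc M"] n Suc.prems(1) by auto
  \<comment> \<open>Tower property: the final average is not affected by the intermediate one on the
    larger box.\<close>
  have "avg_on W (lattice_box (s + r)) u = avg_on W (lattice_box (s + r)) w"
    unfolding w_def using W n lattice_box_mono[of "s + r" "n + r"] by (subst avg_on_avg_on) auto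
  then have "qform s (avg_on W (lattice_box (s + r)) u) (avg_on W (lattice_box (s + r)) u)
      = qform s (avg_on W (lattice_box (s + r)) w) (avg_on W (lattice_box (s + r)) w)" by simp
  also have "\<dots> \<le> ?\<theta> ^ N * qform n w w + real N * (?K * ip w w)"
  proof (rule Suc.IH)
    show "lattice_box (Suc n) \<subseteq> W"
      using lattice_box_mono[of "Suc n" "Suc M"] n Suc.prems(1) by auto
    show "depends_only_on W w"
      unfolding w_def using depends_only_on_avg_on[OF W Suc.prems(2)] by (rule depends_only_on_mono) auto
    show "harmonic_box n w"
      unfolding w_def using Suc.prems lu s n W box by (intro harmonic_box_avg_on[where m = M]) auto
    show "s + N * (h + r) \<le> n" by (rule n)
    show "lattice_box (s + r) \<subseteq> W" by (rule Suc.prems(5))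
  qed
  also have "\<dots> \<le> ?\<theta> ^ N * (?\<theta> * qform M u u + ?K * ip u u) + real N * (?K * ip u u)"
  proof (intro add_mono mult_left_mono)
    show "qform n w w \<le> ?\<theta> * qform M u u + ?K * ip u u"
      unfolding w_def using W Suc.prems h n by (intro caccioppoli_step) auto
    show "ip w w \<le> ip u u" unfolding w_def using W lu by (rule ip_avg_on_le)
  qed (use \<theta> in auto)
  also have "\<dots> \<le> ?\<theta> ^ Suc N * qform M u u + 1 * (?K * ip u u) + real N * (?K * ip u u)"
    using \<theta> ip_self_nonneg[of u] mult_right_mono[of "?\<theta> ^ N" 1 "?K * ip u u"] power_le_one[OF \<theta>]
    by (simp add: algebra_simps)
  finally show ?case by (simp only: of_nat_Suc distrib_right add.assoc)
qed

end

section \<open>Reduction to local functions\<close>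

definition square_integrable :: "real \<Rightarrow> ('d::finite config \<Rightarrow> real) \<Rightarrow> bool" where
  "square_integrable \<rho> f \<longleftrightarrow> f \<in> borel_measurable (bernoulli_measure \<rho>) \<and>
     integrable (bernoulli_measure \<rho>) (\<lambda>\<eta>. (f \<eta>)\<^sup>2)"

lemma square_integrable_local: "local_fn f \<Longrightarrow> square_integrable \<rho> f"
  unfolding square_integrable_def
  by (auto intro: borel_measurable_integrable local_integrable local_fn_unary)

lemma square_integrable_mult:
  assumes "square_integrable \<rho> f" "square_integrable \<rho> g"
  shows "integrable (bernoulli_measure \<rho>) (\<lambda>\<eta>. f \<eta> * g \<eta>)"
proof (rule Bochner_Integration.integrable_bound)
  show "integrable (bernoulli_measure \<rho>) (\<lambda>\<eta>. (f \<eta>)\<^sup>2 + (g \<eta>)\<^sup>2)"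
    using assms by (simp add: square_integrable_def)
  have "\<bar>f \<eta> * g \<eta>\<bar> \<le> (f \<eta>)\<^sup>2 + (g \<eta>)\<^sup>2" for \<eta>
  proof -
    have "2 * (\<bar>f \<eta>\<bar> * \<bar>g \<eta>\<bar>) \<le> (f \<eta>)\<^sup>2 + (g \<eta>)\<^sup>2"
      using sum_squares_bound[of "\<bar>f \<eta>\<bar>" "\<bar>g \<eta>\<bar>"] by simp
    moreover have "0 \<le> \<bar>f \<eta>\<bar> * \<bar>g \<eta>\<bar>" by simp
    ultimately show ?thesis unfolding abs_mult by linarith
  qed
  then show "AE \<eta> in bernoulli_measure \<rho>. norm (f \<eta> * g \<eta>) \<le> norm ((f \<eta>)\<^sup>2 + (g \<eta>)\<^sup>2)"
    by simp
qed (use assms in \<open>auto simp: square_integrable_def\<close>)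

lemma square_integrable_diff:
  assumes "square_integrable \<rho> f" "square_integrable \<rho> g"
  shows "square_integrable \<rho> (\<lambda>\<eta>. f \<eta> - g \<eta>)"
proof -
  have "integrable (bernoulli_measure \<rho>) (\<lambda>\<eta>. (f \<eta>)\<^sup>2 - 2 * (f \<eta> * g \<eta>) + (g \<eta>)\<^sup>2)"
    using assms square_integrable_mult[OF assms] by (simp add: square_integrable_def)
  then show ?thesis
    using assms by (auto simp: square_integrable_def power2_diff algebra_simps)
qed

lemma square_integrable_exchange:
  assumes "square_integrable \<rho> f" "x \<noteq> y"
  shows "square_integrable \<rho> (\<lambda>\<eta>. f (exchange {x, y} \<eta>))"
  using assms integrable_exchange[OF assms(2), of \<rho> "\<lambda>\<eta>. (f \<eta>)\<^sup>2"]
    measurable_compose[OF measurable_exchange[OF assms(2)], of f \<rho> borel]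
  by (simp add: square_integrable_def)

lemma square_integrable_pi_bond:
  "square_integrable \<rho> f \<Longrightarrow> x \<noteq> y \<Longrightarrow> square_integrable \<rho> (pi_bond {x, y} f)"
  unfolding pi_bond_def by (intro square_integrable_diff square_integrable_exchange)

section \<open>Conditional expectations given finitely many sites\<close>

text \<open>No set generated by the sites of \<open>A\<close> separates two configurations that
  agree on \<open>A\<close>. So a conditional expectation given a finite \<open>A\<close> is a local
  function, at every configuration.\<close>

lemma depends_only_on_site_algebra:
  assumes f: "(f :: 'd::finite config \<Rightarrow> real) \<in> borel_measurable (site_algebra A)"
  shows "depends_only_on A f"
  unfolding depends_only_on_def
proof (intro allI impI)
  fix \<eta> \<xi> :: "'d config" assume eq: "\<forall>z\<in>A. \<eta> z = \<xi> z"
  let ?G = "{(\<lambda>\<eta>. \<eta> x) -` B | x B. x \<in> A} :: 'd config set set"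
  have "S \<in> sigma_sets UNIV ?G \<Longrightarrow> \<eta> \<in> S \<longleftrightarrow> \<xi> \<in> S" for S
    by (induction rule: sigma_sets.induct) (use eq in auto)
  moreover have "f -` {f \<xi>} \<inter> UNIV \<in> sigma_sets UNIV ?G"
    using measurable_sets[OF f, of "{f \<xi>}"] by (simp add: site_algebra_def)
  ultimately show "f \<eta> = f \<xi>" by blast
qed

lemma measurable_site_algebra:
  assumes "finite A" "depends_only_on A f"
  shows "f \<in> borel_measurable (site_algebra A)"
proof -
  have sp: "space (site_algebra A :: 'a config measure) = UNIV" by (simp add: site_algebra_def)
  have site: "(\<lambda>\<eta>. \<eta> x) -` B \<in> sets (site_algebra A)" if "x \<in> A" for x :: "'a site" and B
    unfolding site_algebra_def using that by auto
  have "{\<eta>. \<forall>x\<in>A. \<eta> x = (x \<in> S)} \<in> sets (site_algebra A)" for S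
  proof (cases "A = {}")
    case False
    have "{\<eta>. \<forall>x\<in>A. \<eta> x = (x \<in> S)} = (\<Inter>x\<in>A. (\<lambda>\<eta>. \<eta> x) -` {x \<in> S})" by auto
    also have "\<dots> \<in> sets (site_algebra A)"
      using assms False by (intro sets.finite_INT site) auto
    finally show ?thesis .
  next
    case True
    have "UNIV \<in> sets (site_algebra A :: 'a config measure)"
      using sets.top[of "site_algebra A :: 'a config measure"] unfolding sp .
    then show ?thesis using True by simp
  qed
  then have "(\<lambda>\<eta>. \<Sum>S\<in>Pow A. f (\<lambda>x. x \<in> S) * indicator {\<eta>. \<forall>x\<in>A. \<eta> x = (x \<in> S)} \<eta>)
      \<in> borel_measurable (site_algebra A)"
    by (intro borel_measurable_sum borel_measurable_times borel_measurable_const borel_measurable_indicator)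
  then show ?thesis unfolding local_expansion[OF assms, symmetric] .
qed

abbreviation site_cond_exp :: "real \<Rightarrow> 'd::finite site set \<Rightarrow> ('d config \<Rightarrow> real) \<Rightarrow> 'd config \<Rightarrow> real" where
  "site_cond_exp \<rho> A \<equiv> real_cond_exp (bernoulli_measure \<rho>) (site_algebra A)"

lemma depends_only_on_site_cond_exp: "depends_only_on A (site_cond_exp \<rho> A u)"
  by (rule depends_only_on_site_algebra) simp

lemma integral_site_cond_exp:
  assumes A: "finite A" and g: "depends_only_on A g" and u: "square_integrable \<rho> u"
  shows "(\<integral>\<eta>. g \<eta> * site_cond_exp \<rho> A u \<eta> \<partial>bernoulli_measure \<rho>) = (\<integral>\<eta>. g \<eta> * u \<eta> \<partial>bernoulli_measure \<rho>)"
proof -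
  interpret prob_space "bernoulli_measure \<rho>" by (rule prob_space_bernoulli)
  interpret finite_measure_subalgebra "bernoulli_measure \<rho>" "site_algebra A"
    by unfold_locales (rule subalgebra_site_algebra)
  have "square_integrable \<rho> g" using local_fnI[OF A g] by (rule square_integrable_local)
  from square_integrable_mult[OF this u]
  have "integrable (bernoulli_measure \<rho>) (\<lambda>\<eta>. g \<eta> * u \<eta>)" .
  then show ?thesis
    using u measurable_site_algebra[OF A g]
    by (intro real_cond_exp_intg) (auto simp: square_integrable_def)
qed

lemma integral_site_cond_exp_square_le:
  assumes A: "finite A" and u: "square_integrable \<rho> u"
  shows "(\<integral>\<eta>. (site_cond_exp \<rho> A u \<eta>)\<^sup>2 \<partial>bernoulli_measure \<rho>) \<le> (\<integral>\<eta>. (u \<eta>)\<^sup>2 \<partial>bernoulli_measure \<rho>)"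
proof -
  let ?v = "site_cond_exp \<rho> A u"
  have d: "depends_only_on A ?v" by (rule depends_only_on_site_cond_exp)
  have v: "square_integrable \<rho> ?v" using local_fnI[OF A d] by (rule square_integrable_local)
  have i: "integrable (bernoulli_measure \<rho>) (\<lambda>\<eta>. ?v \<eta> * u \<eta>)"
    using v u by (rule square_integrable_mult)
  have "0 \<le> (\<integral>\<eta>. (u \<eta> - ?v \<eta>)\<^sup>2 \<partial>bernoulli_measure \<rho>)" by simp
  also have "\<dots> = (\<integral>\<eta>. (u \<eta>)\<^sup>2 - 2 * (?v \<eta> * u \<eta>) + (?v \<eta>)\<^sup>2 \<partial>bernoulli_measure \<rho>)"
    by (simp add: power2_diff algebra_simps)
  also have "\<dots> = (\<integral>\<eta>. (u \<eta>)\<^sup>2 \<partial>bernoulli_measure \<rho>) - 2 * (\<integral>\<eta>. ?v \<eta> * u \<eta> \<partial>bernoulli_measure \<rho>)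
      + (\<integral>\<eta>. (?v \<eta>)\<^sup>2 \<partial>bernoulli_measure \<rho>)"
    using u v i by (simp add: square_integrable_def)
  also have "(\<integral>\<eta>. ?v \<eta> * u \<eta> \<partial>bernoulli_measure \<rho>) = (\<integral>\<eta>. (?v \<eta>)\<^sup>2 \<partial>bernoulli_measure \<rho>)"
    using integral_site_cond_exp[OF A d u] by (simp add: power2_eq_square)
  finally show ?thesis by simp
qed

context exclusion
begin

section \<open>Dirichlet forms of square-integrable functions and their localization\<close>

lemma square_integrable_rate_mult:
  assumes "square_integrable \<rho> f" "site_norm (x - y) = 1"
  shows "square_integrable \<rho> (\<lambda>\<eta>. c {x, y} \<eta> * f \<eta>)"
  unfolding square_integrable_def
proof
  have m: "c {x, y} \<in> borel_measurable (bernoulli_measure \<rho>)"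
    using square_integrable_local[OF rate_local[OF assms(2)]] by (simp add: square_integrable_def)
  with assms(1) show m': "(\<lambda>\<eta>. c {x, y} \<eta> * f \<eta>) \<in> borel_measurable (bernoulli_measure \<rho>)"
    unfolding square_integrable_def by (intro borel_measurable_times) auto
  show "integrable (bernoulli_measure \<rho>) (\<lambda>\<eta>. (c {x, y} \<eta> * f \<eta>)\<^sup>2)"
  proof (rule Bochner_Integration.integrable_bound)
    show "integrable (bernoulli_measure \<rho>) (\<lambda>\<eta>. lam\<^sup>2 * (f \<eta>)\<^sup>2)"
      using assms by (simp add: square_integrable_def)
    have "(c {x, y} \<eta>)\<^sup>2 \<le> lam\<^sup>2" for \<eta>
      using rate_ge[OF assms(2), of \<eta>] rate_le[OF assms(2), of \<eta>] by (intro power_mono) auto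
    then show "AE \<eta> in bernoulli_measure \<rho>. norm ((c {x, y} \<eta> * f \<eta>)\<^sup>2) \<le> norm (lam\<^sup>2 * (f \<eta>)\<^sup>2)"
      by (simp add: power_mult_distrib mult_right_mono)
  qed (use m' in simp)
qed

text \<open>Reversibility: the exchange preserves the measure and, as a rate ignores the endpoints
  of its bond, also the rate, while it reverses the sign of the gradient of
  \<open>u\<close>.\<close>

lemma bform_eq:
  assumes v: "square_integrable \<rho> v" and u: "square_integrable \<rho> u"
    and xy: "site_norm (x - y) = 1" "x \<noteq> y"
  shows "integrable (bernoulli_measure \<rho>) (\<lambda>\<eta>. v \<eta> * (c {x, y} \<eta> * pi_bond {x, y} u \<eta>))"
    and "integrable (bernoulli_measure \<rho>) (\<lambda>\<eta>. c {x, y} \<eta> * pi_bond {x, y} v \<eta> * pi_bond {x, y} u \<eta>)"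
    and "bform {x, y} v u = - 2 * (\<integral>\<eta>. v \<eta> * (c {x, y} \<eta> * pi_bond {x, y} u \<eta>) \<partial>bernoulli_measure \<rho>)"
proof -
  let ?e = "exchange {x, y}"
  let ?F = "\<lambda>\<eta>. v \<eta> * (c {x, y} \<eta> * pi_bond {x, y} u \<eta>)"
  let ?F' = "\<lambda>\<eta>. v (?e \<eta>) * (c {x, y} \<eta> * pi_bond {x, y} u \<eta>)"
  have sq: "square_integrable \<rho> (\<lambda>\<eta>. c {x, y} \<eta> * pi_bond {x, y} w \<eta>)" if "square_integrable \<rho> w" for w
    using that xy by (intro square_integrable_rate_mult square_integrable_pi_bond)
  show i: "integrable (bernoulli_measure \<rho>) ?F"
    using v sq[OF u] by (rule square_integrable_mult)
  show "integrable (bernoulli_measure \<rho>) (\<lambda>\<eta>. c {x, y} \<eta> * pi_bond {x, y} v \<eta> * pi_bond {x, y} u \<eta>)"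
    using sq[OF v] u xy(2) by (intro square_integrable_mult square_integrable_pi_bond)
  have i': "integrable (bernoulli_measure \<rho>) ?F'"
    using square_integrable_exchange[OF v xy(2)] sq[OF u] by (rule square_integrable_mult)
  have "(\<integral>\<eta>. ?F (?e \<eta>) \<partial>bernoulli_measure \<rho>) = (\<integral>\<eta>. ?F \<eta> \<partial>bernoulli_measure \<rho>)"
    using i by (intro integral_exchange xy) auto
  moreover have "?F (?e \<eta>) = - ?F' \<eta>" for \<eta>
    using rate_exchange[OF xy, of \<eta>] exchange_exchange[OF xy(2), of \<eta>]
    by (simp add: pi_bond_def algebra_simps)
  ultimately have "- (\<integral>\<eta>. ?F' \<eta> \<partial>bernoulli_measure \<rho>) = (\<integral>\<eta>. ?F \<eta> \<partial>bernoulli_measure \<rho>)" by simp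
  moreover have "bform {x, y} v u = (\<integral>\<eta>. ?F' \<eta> - ?F \<eta> \<partial>bernoulli_measure \<rho>)"
    unfolding bform_def ip_def
    by (rule Bochner_Integration.integral_cong) (simp_all add: pi_bond_def algebra_simps)
  moreover have "\<dots> = (\<integral>\<eta>. ?F' \<eta> \<partial>bernoulli_measure \<rho>) - (\<integral>\<eta>. ?F \<eta> \<partial>bernoulli_measure \<rho>)"
    using i' i by (rule Bochner_Integration.integral_diff)
  ultimately show "bform {x, y} v u = - 2 * (\<integral>\<eta>. ?F \<eta> \<partial>bernoulli_measure \<rho>)" by simp
qed

lemma energy_eq_qform:
  assumes "square_integrable \<rho> v" "square_integrable \<rho> u"
  shows "energy c \<rho> (lattice_box m) v u = qform m v u / 2"
proof -
  have bond: "integrable (bernoulli_measure \<rho>) (\<lambda>\<eta>. v \<eta> * (c b \<eta> * pi_bond b u \<eta>)) \<and>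
      bform b v u = - 2 * (\<integral>\<eta>. v \<eta> * (c b \<eta> * pi_bond b u \<eta>) \<partial>bernoulli_measure \<rho>)"
    if b: "b \<in> closed_bonds (lattice_box m)" for b
  proof -
    obtain x y where "b = {x, y}" "x \<noteq> y" "site_norm (x - y) = 1" using b by (rule closed_bondsE)
    then show ?thesis using bform_eq(1,3)[OF assms, of x y] by simp
  qed
  have "energy c \<rho> (lattice_box m) v u
      = - (\<integral>\<eta>. (\<Sum>b\<in>closed_bonds (lattice_box m). v \<eta> * (c b \<eta> * pi_bond b u \<eta>)) \<partial>bernoulli_measure \<rho>)"
    unfolding energy_def generator_def by (simp add: sum_distrib_left)
  also have "\<dots> = - (\<Sum>b\<in>closed_bonds (lattice_box m). (\<integral>\<eta>. v \<eta> * (c b \<eta> * pi_bond b u \<eta>) \<partial>bernoulli_measure \<rho>))"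
    using bond by (subst Bochner_Integration.integral_sum) auto
  also have "\<dots> = - (\<Sum>b\<in>closed_bonds (lattice_box m). - bform b v u / 2)"
    using bond by (simp cong: sum.cong)
  also have "\<dots> = qform m v u / 2"
    unfolding qform_def by (simp add: sum_negf sum_divide_distrib)
  finally show ?thesis .
qed

text \<open>Summation by parts leaves \<open>u\<close> multiplied by \<open>c b\<close> times the
  gradient of \<open>v\<close>. The box of radius \<open>m + r + 1\<close> contains the endpoints
  and the range of the rate, so this factor is a function of \<open>W\<close> and conditioning is
  invisible to it.\<close>

lemma bform_site_cond_exp:
  assumes u: "square_integrable \<rho> u" and v: "depends_only_on W v"
    and W: "finite W" "lattice_box (Suc (m + r)) \<subseteq> W" and b: "b \<in> closed_bonds (lattice_box m)"
  shows "bform b (site_cond_exp \<rho> W u) v = bform b u v"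
proof -
  obtain x y where xy: "b = {x, y}" "x \<noteq> y" "site_norm (x - y) = 1" "sup_norm x \<le> m"
    "sup_norm y \<le> sup_norm x + 1" using b by (rule closed_bondsE)
  have sv: "square_integrable \<rho> v" using local_fnI[OF W(1) v] by (rule square_integrable_local)
  have su: "square_integrable \<rho> (site_cond_exp \<rho> W u)"
    using local_fnI[OF W(1) depends_only_on_site_cond_exp] by (rule square_integrable_local)
  have "depends_only_on W (pi_bond {x, y} v)"
    using W xy by (intro depends_only_on_pi_bond v) (auto simp: lattice_box_def)
  moreover have "depends_only_on W (c {x, y})"
    using rate_box[OF xy(3)] by (rule depends_only_on_mono) (use W xy in \<open>auto simp: lattice_box_def\<close>)
  ultimately have "depends_only_on W (\<lambda>\<eta>. c {x, y} \<eta> * pi_bond {x, y} v \<eta>)"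
    using depends_only_on_compose2[of W "c {x, y}" "pi_bond {x, y} v" "(*)"] by simp
  from integral_site_cond_exp[OF W(1) this u]
  show ?thesis
    unfolding xy(1) bform_eq(3)[OF u sv xy(3,2)] bform_eq(3)[OF su sv xy(3,2)] by (simp add: mult.commute)
qed

lemma bform_commute: "bform b v u = bform b u v"
  by (simp add: bform_def ip_def mult_ac)

text \<open>Pythagoras in the form of each bond; \<open>bform_site_cond_exp\<close> evaluates the
  cross term.\<close>

lemma qform_site_cond_exp_le:
  assumes u: "square_integrable \<rho> u" and W: "finite W" "lattice_box (Suc (m + r)) \<subseteq> W"
  shows "qform m (site_cond_exp \<rho> W u) (site_cond_exp \<rho> W u) \<le> qform m u u"
  unfolding qform_def
proof (rule sum_mono)
  fix b :: "'d site set" assume b: "b \<in> closed_bonds (lattice_box m)"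
  obtain x y where xy: "b = {x, y}" "x \<noteq> y" "site_norm (x - y) = 1" using b by (rule closed_bondsE)
  let ?v = "site_cond_exp \<rho> W u"
  have dv: "depends_only_on W ?v" by (rule depends_only_on_site_cond_exp)
  have sv: "square_integrable \<rho> ?v" using local_fnI[OF W(1) dv] by (rule square_integrable_local)
  have "0 \<le> (\<integral>\<eta>. c b \<eta> * (pi_bond b u \<eta> - pi_bond b ?v \<eta>)\<^sup>2 \<partial>bernoulli_measure \<rho>)"
    unfolding xy(1) using order_trans[OF zero_le_one rate_ge[OF xy(3)]]
    by (intro Bochner_Integration.integral_nonneg mult_nonneg_nonneg) auto
  also have "\<dots> = (\<integral>\<eta>. c b \<eta> * pi_bond b u \<eta> * pi_bond b u \<eta> - 2 * (c b \<eta> * pi_bond b u \<eta> * pi_bond b ?v \<eta>)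
      + c b \<eta> * pi_bond b ?v \<eta> * pi_bond b ?v \<eta> \<partial>bernoulli_measure \<rho>)"
    by (simp add: power2_eq_square algebra_simps)
  also have "\<dots> = bform b u u - 2 * bform b u ?v + bform b ?v ?v"
    unfolding bform_def ip_def xy(1)
    using bform_eq(2)[OF u u xy(3,2)] bform_eq(2)[OF u sv xy(3,2)] bform_eq(2)[OF sv sv xy(3,2)] by simp
  also have "bform b u ?v = bform b ?v ?v"
    by (rule bform_site_cond_exp[symmetric, OF u dv W b])
  finally show "bform b ?v ?v \<le> bform b u u" by simp
qed

lemma harmonic_box_site_cond_exp:
  assumes u: "u \<in> harmonic c \<rho> (lattice_box m)" and sq: "square_integrable \<rho> u" and m: "0 < m"
    and W: "finite W" "lattice_box (Suc (m + r)) \<subseteq> W"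
  shows "harmonic_box m (site_cond_exp \<rho> W u)"
  unfolding harmonic_box_def
proof (intro allI impI)
  fix v :: "'d config \<Rightarrow> real" assume v: "depends_only_on (lattice_box (m - 1)) v"
  have vW: "depends_only_on W v"
    by (rule depends_only_on_mono[OF v], rule order_trans[OF lattice_box_mono W(2)]) simp
  have "depends_only_on (lattice_interior (lattice_box m)) v"
    using lattice_box_subset_interior[of "m - 1"] m by (intro depends_only_on_mono[OF v]) auto
  then have "energy c \<rho> (lattice_box m) v u = 0" using u by (simp add: harmonic_def)
  then have "qform m v u = 0"
    using energy_eq_qform[OF square_integrable_local[OF local_fnI[OF W(1) vW]] sq] by simp
  moreover have "qform m v (site_cond_exp \<rho> W u) = qform m v u"
    unfolding qform_def bform_commute[of _ v] using bform_site_cond_exp[OF sq vW W] by (intro sum.cong) auto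
  ultimately show "qform m v (site_cond_exp \<rho> W u) = 0" by simp
qed

text \<open>The difference \<open>g\<close> of the two sides depends only on \<open>V\<close>, and
  both sides have the same inner product with it, namely that of \<open>u\<close>. So
  \<open>g\<close> has norm zero, and \<open>local_eq_0\<close> gives equality at every
  configuration.\<close>

lemma site_cond_exp_eq_avg_on:
  assumes u: "square_integrable \<rho> u" and W: "finite W" and V: "V \<subseteq> W"
  shows "site_cond_exp \<rho> V u = avg_on W V (site_cond_exp \<rho> W u)"
proof -
  have fV: "finite V" using V W finite_subset by blast
  let ?w = "site_cond_exp \<rho> W u" and ?v = "site_cond_exp \<rho> V u"
  define g where "g = (\<lambda>\<eta>. ?v \<eta> - avg_on W V ?w \<eta>)"
  have dw: "depends_only_on W ?w" and dv: "depends_only_on V ?v" by (rule depends_only_on_site_cond_exp)+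
  have lw: "local_fn ?w" using W dw by (rule local_fnI)
  have da: "depends_only_on V (avg_on W V ?w)"
    using depends_only_on_avg_on[OF W dw] by (rule depends_only_on_mono) auto
  have dg: "depends_only_on V g" unfolding g_def using dv da by (rule depends_only_on_compose2)
  have lg: "local_fn g" using fV dg by (rule local_fnI)
  have "ip g g = ip ?v g - ip (avg_on W V ?w) g"
    unfolding g_def[of] using lg local_fnI[OF fV dv] local_fnI[OF fV da]
    by (intro ip_diff_left) (simp_all add: g_def)
  also have "ip ?v g = ip g u"
    using integral_site_cond_exp[OF fV dg u] by (simp add: ip_def mult.commute)
  also have "ip (avg_on W V ?w) g = ip ?w g"
    using ip_avg_on[OF W lw lg] avg_on_fixed[OF W dg] by simp
  also have "ip ?w g = ip g u"
    using integral_site_cond_exp[OF W depends_only_on_mono[OF dg V] u] by (simp add: ip_def mult.commute)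
  finally have "(\<integral>\<eta>. (g \<eta>)\<^sup>2 \<partial>bernoulli_measure \<rho>) = 0" by (simp add: ip_def power2_eq_square)
  from local_eq_0[OF fV dg density this] show ?thesis
    unfolding g_def by (simp add: fun_eq_iff)
qed

end

section \<open>The cubes of the theorem\<close>

text \<open>The largest integer strictly below \<open>L / 2\<close>, as the cube is open.\<close>

definition radius :: "real \<Rightarrow> nat" where
  "radius L = nat (\<lceil>L / 2\<rceil> - 1)"

lemma radius_bounds:
  assumes "0 < L" shows "real (radius L) < L / 2" "L / 2 - 1 \<le> real (radius L)"
proof -
  have "0 < \<lceil>L / 2\<rceil>" using assms by simp
  then have "real (radius L) = real_of_int \<lceil>L / 2\<rceil> - 1" unfolding radius_def by simp
  then show "real (radius L) < L / 2" "L / 2 - 1 \<le> real (radius L)" by linarith+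
qed

text \<open>Exact because \<open>r\<close> is an integer: the enlarged cube of the theorem is
  precisely the box on which the iteration averages.\<close>

lemma radius_add:
  assumes "0 < L" shows "radius (L + 2 * real r) = radius L + r"
proof -
  have "\<lceil>(L + 2 * real r) / 2\<rceil> = \<lceil>L / 2\<rceil> + int r"
    using ceiling_add_of_int[of "L / 2" "int r"] by (simp add: add_divide_distrib)
  moreover have "0 < \<lceil>L / 2\<rceil>" using assms by simp
  ultimately show ?thesis unfolding radius_def by linarith
qed

lemma cube_eq_lattice_box:
  assumes "0 < L" shows "cube L = lattice_box (radius L)"
proof -
  have "0 < \<lceil>L / 2\<rceil>" using assms by simp
  have eq: "- L / 2 < real_of_int k \<and> real_of_int k < L / 2 \<longleftrightarrow> \<bar>k\<bar> \<le> int (radius L)" for k :: int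
  proof -
    have eq: "- L / 2 < real_of_int k \<and> real_of_int k < L / 2 \<longleftrightarrow> real_of_int \<bar>k\<bar> < L / 2" by auto
    also have "\<dots> \<longleftrightarrow> \<bar>k\<bar> < \<lceil>L / 2\<rceil>" by (simp only: less_ceiling_iff)
    finally show ?thesis using \<open>0 < \<lceil>L / 2\<rceil>\<close> by (auto simp: radius_def)
  qed
  show ?thesis unfolding set_eq_iff cube_def mem_lattice_box mem_Collect_eq eq by blast
qed

lemma square_integrable_H1:
  assumes "u \<in> H1 \<rho> \<Lambda>" shows "square_integrable \<rho> u"
proof -
  have m: "u \<in> borel_measurable (bernoulli_measure \<rho>)"
    and "(\<integral>\<^sup>+ \<eta>. ennreal ((u \<eta>)\<^sup>2) \<partial>bernoulli_measure \<rho>) < \<infinity>"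
    using assms unfolding H1_def by (auto simp: ennreal_add_eq_top less_top)
  then have "integrable (bernoulli_measure \<rho>) (\<lambda>\<eta>. (u \<eta>)\<^sup>2)"
    by (intro integrableI_nonneg) auto
  with m show ?thesis by (simp add: square_integrable_def)
qed

text \<open>The radii differ by more than \<open>L - 1\<close>. The layers use at most
  \<open>L / 2\<close> of this and the margins at most \<open>L / 2 - 1\<close>, by the second bound
  on \<open>L\<close>. As \<open>h\<close> is at least \<open>L / (4 * N)\<close>, the error is
  \<open>N * 16 * 16 * N\<^sup>2 / L\<^sup>2\<close>, up to the dimension and
  \<open>lam\<^sup>2\<close>.\<close>

lemma (in exclusion) caccioppoli_cube:
  assumes L: "5 \<le> L" "2 * real N * (real r + 1) + 2 \<le> L" and N: "0 < N"
    and u: "u \<in> harmonic c \<rho> (cube (3 * L))"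
  shows "energy c \<rho> (cube L) (local_average \<rho> (L + 2 * real r) u) (local_average \<rho> (L + 2 * real r) u)
    \<le> ((lam + 1 / 2) / (lam + 1)) ^ N * energy c \<rho> (cube (3 * L)) u u
      + 256 * real CARD('d) * lam\<^sup>2 * real N ^ 3 / L\<^sup>2 * (\<integral>\<eta>. (u \<eta>)\<^sup>2 \<partial>bernoulli_measure \<rho>)"
proof -
  define s where "s = radius L"
  define M where "M = radius (3 * L)"
  define W :: "'d site set" where "W = lattice_box (Suc (M + r))"
  define h where "h = nat \<lfloor>L / (2 * real N)\<rfloor>"
  let ?\<theta> = "(lam + 1 / 2) / (lam + 1)"
  let ?U = "\<integral>\<eta>. (u \<eta>)\<^sup>2 \<partial>bernoulli_measure \<rho>"
  have cubes: "cube L = lattice_box s" "cube (3 * L) = lattice_box M" "cube (L + 2 * real r) = lattice_box (s + r)"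
    using L radius_add[of L r] by (simp_all add: cube_eq_lattice_box s_def M_def)
  have sM: "real s < L / 2" "L / 2 - 1 \<le> real s" "3 * L / 2 - 1 \<le> real M"
    using radius_bounds[of L] radius_bounds[of "3 * L"] L by (auto simp: s_def M_def)
  have s: "0 < s" and M: "0 < M" and sM': "s < M" using sM L by linarith+
  have q: "1 \<le> L / (2 * real N)"
  proof -
    have "2 * real N * 1 \<le> 2 * real N * (real r + 1)" by (intro mult_left_mono) auto
    then have "2 * real N \<le> L" using L(2) by linarith
    then show ?thesis using N by (simp add: pos_le_divide_eq)
  qed
  have h_floor: "real h = real_of_int \<lfloor>L / (2 * real N)\<rfloor>" using q by (simp add: h_def)
  have h: "0 < h" using q h_floor by linarith
  have h_le: "real h \<le> L / (2 * real N)" using h_floor by simp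
  have "z / 2 \<le> real_of_int \<lfloor>z\<rfloor>" if "1 \<le> z" for z :: real
  proof -
    have "1 \<le> \<lfloor>z\<rfloor>" using that by simp
    then show ?thesis by linarith
  qed
  from this[OF q] have h_ge: "L / (4 * real N) \<le> real h" using h_floor by simp
  have "real N * real h \<le> L / 2" using h_le N by (simp add: field_simps)
  moreover have "2 * (real N * real r) + 2 \<le> L"
    using L(2) by (simp add: algebra_simps)
  ultimately have "real (s + N * (h + r)) \<le> real M"
    using sM by (simp add: distrib_left)
  then have range: "s + N * (h + r) \<le> M" by (simp only: of_nat_le_iff)
  have fW: "finite W" by (simp add: W_def)
  define w where "w = site_cond_exp \<rho> W u"
  have sq: "square_integrable \<rho> u" using u square_integrable_H1 by (auto simp: harmonic_def)
  have dw: "depends_only_on W w" unfolding w_def by (rule depends_only_on_site_cond_exp)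
  have box: "lattice_box (s + r) \<subseteq> W" "lattice_box (Suc M) \<subseteq> W" "lattice_box (Suc (M + r)) \<subseteq> W"
    using sM' unfolding W_def by (auto intro!: lattice_box_mono)
  define A where "A = avg_on W (lattice_box (s + r)) w"
  have lA: "local_fn A" unfolding A_def using fW local_fnI[OF fW dw] by blast
  have "local_average \<rho> (L + 2 * real r) u = A"
    unfolding local_average_def cubes A_def w_def using sq fW box(1) by (rule site_cond_exp_eq_avg_on)
  then have "energy c \<rho> (cube L) (local_average \<rho> (L + 2 * real r) u) (local_average \<rho> (L + 2 * real r) u)
      = qform s A A / 2"
    unfolding cubes(1) using energy_eq_qform[OF square_integrable_local[OF lA] square_integrable_local[OF lA]] by simp
  also have "qform s A A \<le> ?\<theta> ^ N * qform M w w
      + real N * (16 * real CARD('d) * lam\<^sup>2 / (real h)\<^sup>2 * ip w w)"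
    unfolding A_def
  proof (rule caccioppoli_iterated[OF fW s h box(2) dw _ range box(1)])
    show "harmonic_box M w"
      unfolding w_def using u sq M fW box(3) by (intro harmonic_box_site_cond_exp) (simp_all add: cubes)
  qed
  also have "\<dots> \<le> ?\<theta> ^ N * qform M u u + real N * (16 * real CARD('d) * lam\<^sup>2 * (16 * (real N)\<^sup>2 / L\<^sup>2) * ?U)"
  proof -
    have "qform M w w \<le> qform M u u" unfolding w_def by (rule qform_site_cond_exp_le[OF sq fW box(3)])
    then have 1: "?\<theta> ^ N * qform M w w \<le> ?\<theta> ^ N * qform M u u"
      using lam_ge by (intro mult_left_mono) auto
    have U: "ip w w \<le> ?U"
      using integral_site_cond_exp_square_le[OF fW sq] by (simp add: ip_def w_def power2_eq_square)
    have "(L / (4 * real N))\<^sup>2 \<le> (real h)\<^sup>2" using h_ge L by (intro power_mono) auto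
    then have "1 / (real h)\<^sup>2 \<le> 1 / (L / (4 * real N))\<^sup>2" using L N h by (intro divide_left_mono) auto
    also have "\<dots> = 16 * (real N)\<^sup>2 / L\<^sup>2" by (simp add: power_divide power_mult_distrib)
    finally have "16 * real CARD('d) * lam\<^sup>2 * (1 / (real h)\<^sup>2) * ip w w
        \<le> 16 * real CARD('d) * lam\<^sup>2 * (16 * (real N)\<^sup>2 / L\<^sup>2) * ?U"
      using U ip_self_nonneg[of w] by (intro mult_mono mult_left_mono) auto
    then have "real N * (16 * real CARD('d) * lam\<^sup>2 / (real h)\<^sup>2 * ip w w)
        \<le> real N * (16 * real CARD('d) * lam\<^sup>2 * (16 * (real N)\<^sup>2 / L\<^sup>2) * ?U)"
      by (intro mult_left_mono) auto
    with 1 show ?thesis by linarith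
  qed
  also have "real N * (16 * real CARD('d) * lam\<^sup>2 * (16 * (real N)\<^sup>2 / L\<^sup>2) * ?U)
      = 256 * real CARD('d) * lam\<^sup>2 * real N ^ 3 / L\<^sup>2 * ?U" (is "_ = ?R")
    by (simp add: power3_eq_cube power2_eq_square)
  finally have "energy c \<rho> (cube L) (local_average \<rho> (L + 2 * real r) u) (local_average \<rho> (L + 2 * real r) u)
      \<le> (?\<theta> ^ N * qform M u u + ?R) / 2" by simp
  \<comment> \<open>The 1/2 relating \<open>energy\<close> to \<open>qform\<close> is kept for the
    energy term and given away for the error.\<close>
  also have "\<dots> \<le> ?\<theta> ^ N * (qform M u u / 2) + ?R"
  proof -
    have "0 \<le> ?R" by simp
    then show ?thesis by argo
  qed
  also have "qform M u u / 2 = energy c \<rho> (cube (3 * L)) u u"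
    unfolding cubes(2) using sq sq by (rule energy_eq_qform[symmetric])
  finally show ?thesis .
qed

text \<open>The base 4 instead of 3 absorbs rounding: the sides are at most \<open>3 * L + 1\<close>
  and at least \<open>L - 1\<close>, and \<open>3 * L + 1 \<le> 4 * (L - 1)\<close> holds from
  \<open>L = 5\<close> on.\<close>

lemma card_cube_triple_le:
  assumes "5 \<le> L"
  shows "real (card (cube (3 * L) :: 'd::finite site set)) \<le> 4 ^ CARD('d) * real (card (cube L :: 'd site set))"
proof -
  have "real (radius (3 * L)) < 3 * L / 2" "L / 2 - 1 \<le> real (radius L)"
    using radius_bounds[of L] radius_bounds[of "3 * L"] assms by auto
  then have "real (2 * radius (3 * L) + 1) \<le> 4 * real (2 * radius L + 1)"
    using assms by simp
  then have "real (2 * radius (3 * L) + 1) ^ CARD('d) \<le> (4 * real (2 * radius L + 1)) ^ CARD('d)"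
    by (intro power_mono) auto
  moreover have "card (cube (3 * L) :: 'd site set) = (2 * radius (3 * L) + 1) ^ CARD('d)"
    "card (cube L :: 'd site set) = (2 * radius L + 1) ^ CARD('d)"
    using assms by (simp_all add: cube_eq_lattice_box card_lattice_box)
  ultimately show ?thesis by (simp only: of_nat_power power_mult_distrib)
qed

theorem proposition2p6:
  fixes lam :: real
  shows "\<exists>\<theta> C :: real. 0 < \<theta> \<and> \<theta> < 1 \<and> 0 < C \<and>
    (\<forall>r :: nat. 0 < r \<longrightarrow>
      (\<exists>R0 :: real. 0 < R0 \<and>
        (\<forall>c :: ('d::finite) site set \<Rightarrow> 'd config \<Rightarrow> real. admissible_rates r lam c \<longrightarrow>
          (\<forall>\<rho> L u. 0 < \<rho> \<and> \<rho> < 1 \<and> R0 \<le> L \<and> u \<in> harmonic c \<rho> (cube (3 * L)) \<longrightarrow>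
            1 / real (card (cube L :: 'd site set)) *
              energy c \<rho> (cube L) (local_average \<rho> (L + 2 * real r) u)
                                 (local_average \<rho> (L + 2 * real r) u)
            \<le> C * L powi (-2) / real (card (cube (3 * L) :: 'd site set)) *
                (\<integral>\<eta>. (u \<eta>)\<^sup>2 \<partial>bernoulli_measure \<rho>)
              + \<theta> / real (card (cube (3 * L) :: 'd site set)) *
                energy c \<rho> (cube (3 * L)) u u))))"
proof -
  \<comment> \<open>At this point \<open>lam\<close> is an arbitrary real; the absolute value keeps
    \<alpha> in the open unit interval and disappears once admissible rates give
    \<open>lam_ge\<close>.\<close>
  define \<alpha> where "\<alpha> = (\<bar>lam\<bar> + 1 / 2) / (\<bar>lam\<bar> + 1)"
  have "0 < \<alpha>" "\<alpha> < 1" by (auto simp: \<alpha>_def field_simps)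
  \<comment> \<open>\<open>N\<close> depends only on the dimension and \<open>lam\<close>. It beats
    the volume ratio with a factor 2 to spare, so that \<theta> can be 1/2.\<close>
  obtain N where N': "\<alpha> ^ N < 1 / (2 * 4 ^ CARD('d))"
    using real_arch_pow_inv[OF _ \<open>\<alpha> < 1\<close>, of "1 / (2 * 4 ^ CARD('d))"] by auto
  have N: "4 ^ CARD('d) * \<alpha> ^ N \<le> 1 / 2" using N' by (simp add: field_simps)
  have N_pos: "0 < N"
  proof (rule ccontr)
    assume "\<not> 0 < N"
    then have "(4::real) ^ CARD('d) \<le> 1 / 2" using N by simp
    moreover have "1 \<le> (4::real) ^ CARD('d)" by simp
    ultimately show False by linarith
  qed
  define K where "K = 256 * real CARD('d) * lam\<^sup>2 * real N ^ 3"
  \<comment> \<open>The summand 1 keeps \<open>C\<close> positive even when \<open>K\<close>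
    vanishes.\<close>
  define C where "C = 4 ^ CARD('d) * K + 1"
  have K: "0 \<le> K" by (simp add: K_def)
  have C: "0 < C" using K by (simp add: C_def add_nonneg_pos)
  show ?thesis
  proof (rule exI[of _ "1 / 2"], rule exI[of _ C], intro conjI allI impI)
    fix r :: nat assume r: "0 < r"
    define R0 where "R0 = 2 * real N * (real r + 1) + 5"
    show "\<exists>R0 :: real. 0 < R0 \<and>
        (\<forall>c :: ('d::finite) site set \<Rightarrow> 'd config \<Rightarrow> real. admissible_rates r lam c \<longrightarrow>
          (\<forall>\<rho> L u. 0 < \<rho> \<and> \<rho> < 1 \<and> R0 \<le> L \<and> u \<in> harmonic c \<rho> (cube (3 * L)) \<longrightarrow>
            1 / real (card (cube L :: 'd site set)) *
              energy c \<rho> (cube L) (local_average \<rho> (L + 2 * real r) u)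
                                 (local_average \<rho> (L + 2 * real r) u)
            \<le> C * L powi (-2) / real (card (cube (3 * L) :: 'd site set)) *
                (\<integral>\<eta>. (u \<eta>)\<^sup>2 \<partial>bernoulli_measure \<rho>)
              + (1 / 2) / real (card (cube (3 * L) :: 'd site set)) *
                energy c \<rho> (cube (3 * L)) u u))"
    proof (rule exI[of _ R0], intro conjI allI impI; (elim conjE)?)
      have "0 \<le> 2 * real N * (real r + 1)" by simp
      then show "0 < R0" unfolding R0_def by linarith
      fix c :: "'d site set \<Rightarrow> 'd config \<Rightarrow> real" and \<rho> L :: real and u :: "'d config \<Rightarrow> real"
      assume c: "admissible_rates r lam c" and \<rho>: "0 < \<rho>" "\<rho> < 1" and L: "R0 \<le> L"
        and u: "u \<in> harmonic c \<rho> (cube (3 * L))"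
      interpret exclusion \<rho> c r lam by unfold_locales (use c \<rho> r in auto)
      have L': "5 \<le> L" "2 * real N * (real r + 1) + 2 \<le> L"
        using L \<open>0 \<le> 2 * real N * (real r + 1)\<close> unfolding R0_def by linarith+
      let ?E = "energy c \<rho> (cube (3 * L)) u u" and ?U = "\<integral>\<eta>. (u \<eta>)\<^sup>2 \<partial>bernoulli_measure \<rho>"
      let ?a = "real (card (cube L :: 'd site set))" and ?b = "real (card (cube (3 * L) :: 'd site set))"
      let ?X = "energy c \<rho> (cube L) (local_average \<rho> (L + 2 * real r) u) (local_average \<rho> (L + 2 * real r) u)"
      have "\<alpha> = (lam + 1 / 2) / (lam + 1)" using lam_ge by (simp add: \<alpha>_def)
      then have X: "?X \<le> \<alpha> ^ N * ?E + K / L\<^sup>2 * ?U"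
        using caccioppoli_cube[OF L' N_pos u] by (simp add: K_def)
      have sq: "square_integrable \<rho> u" using u square_integrable_H1 by (auto simp: harmonic_def)
      \<comment> \<open>Nonnegativity is what permits replacing the prefactor \<open>1 / ?a\<close>
        by the larger \<open>4 ^ CARD('d) / ?b\<close>.\<close>
      have E: "0 \<le> ?E"
      proof -
        have "0 \<le> bform b u u" if b: "b \<in> closed_bonds (lattice_box m)" for b m
        proof -
          obtain x y where xy: "b = {x, y}" "site_norm (x - y) = 1" using b by (rule closed_bondsE)
          have "0 \<le> c b \<eta>" for \<eta> unfolding xy(1) using rate_ge[OF xy(2), of \<eta>] by simp
          then show ?thesis unfolding bform_def ip_def by (intro Bochner_Integration.integral_nonneg) (simp add: mult.assoc)
        qed
        then have "0 \<le> qform (radius (3 * L)) u u" unfolding qform_def by (intro sum_nonneg)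
        moreover have "?E = qform (radius (3 * L)) u u / 2"
          using L' energy_eq_qform[OF sq sq] by (simp add: cube_eq_lattice_box)
        ultimately show ?thesis by simp
      qed
      have ab: "0 < ?a" "0 < ?b" "?b \<le> 4 ^ CARD('d) * ?a"
        using L' card_cube_triple_le[OF L'(1), where ?'d = 'd] by (simp_all add: cube_eq_lattice_box card_lattice_box)
      then have inv: "1 / ?a \<le> 4 ^ CARD('d) / ?b" by (simp add: field_simps)
      have "1 / ?a * ?X \<le> 1 / ?a * (\<alpha> ^ N * ?E + K / L\<^sup>2 * ?U)"
        using X by (intro mult_left_mono) auto
      also have "\<dots> \<le> 4 ^ CARD('d) / ?b * (\<alpha> ^ N * ?E + K / L\<^sup>2 * ?U)"
        using inv E K \<open>0 < \<alpha>\<close> by (intro mult_right_mono add_nonneg_nonneg mult_nonneg_nonneg) auto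
      also have "\<dots> = (4 ^ CARD('d) * K) / L\<^sup>2 / ?b * ?U + (4 ^ CARD('d) * \<alpha> ^ N) / ?b * ?E"
        by (simp add: distrib_left mult_ac)
      also have "\<dots> \<le> C / L\<^sup>2 / ?b * ?U + (1 / 2) / ?b * ?E"
        using E N ab by (intro add_mono mult_right_mono divide_right_mono) (auto simp: C_def)
      also have "C / L\<^sup>2 = C * L powi (-2)"
        by (simp add: power_int_minus divide_inverse)
      finally show "1 / ?a * ?X \<le> C * L powi (-2) / ?b * ?U + (1 / 2) / ?b * ?E" .
    qed
  qed (use C in auto)
qed

end
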